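(* Let $d\ge 2$. Let $r$ be a real number with $0<r<r_{\mathrm{stabi}}$, where $r_{\mathrm{stabi}}=9-4\sqrt5$, let $\theta_0\in\,]\pi/2,\pi]$ be an angle such that $$-\cos\theta_0>\frac{2r^{1/3}(1+r^{1/3})}{1+r},$$ and let $\delta_\theta$ be any positive real number. Then there exists a set $\mathcal{ZK}$ of initial configurations of three inelastic particles $0,1,2$ in $\mathbb{R}^d$, with non-empty interior (in the phase space $\mathcal{D}_3$), such that the trajectory $Z(t)$ of the $r$-inelastic hard sphere flow issued from any initial configuration $Z_0\in\mathcal{ZK}$ experiences a nearly-linear inelastic collapse in finite time, with particle $0$ as the central particle. In addition, the final angle $\overline\theta=\overline\theta(Z_0)$ at the time of the inelastic collapse, formed by the external particles $1$ and $2$ around particle $0$, satisfies $$\left|(-\cos\overline\theta)-(-\cos\theta_0)\right|\le\delta_\theta .$$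
   Context: Model. Three identical spherical particles $0,1,2$ of diameter $1$ in $\mathbb{R}^d$ ($d\ge2$), with positions $x_i$ and velocities $v_i$. Phase space: $\mathcal{D}_3=\{(x_0,x_1,x_2,v_0,v_1,v_2)\in\mathbb{R}^{6d} : |x_i-x_j|\ge 1 \text{ for all } i\ne j\}$. The $r$-inelastic hard sphere flow, $r\in\,]0,1[$: between collisions each particle moves in a straight line with constant velocity; when $|x_i-x_j|=1$ for a pair $i\neq j$ (a collision of type $i$-$j$), the velocities of these two particles are immediately changed into $v_i'=v_i-\frac{1+r}{2}\big((v_i-v_j)\cdot\omega\big)\omega$ and $v_j'=v_j+\frac{1+r}{2}\big((v_i-v_j)\cdot\omega\big)\omega$, with $\omega=(x_i-x_j)/|x_i-x_j|$, the velocity of the third particle being unchanged. Inelastic collapse at time $\tau^*>0$: the system evolves according to this flow on $[0,\tau^*[$ and there is an increasing sequence $(t_n)_{n\in\mathbb{N}}$ with $t_0=0$, $t_n\to\tau^*$, such that the $t_n$ are exactly the times of collisions (no accumulation point other than $\tau^*$, free motion on each $]t_n,t_{n+1}[$). Only well-defined trajectories are considered: no triple collision and no grazing collision takes place on $[0,\tau^*[$. Nearly-linear collapse with central particle $0$: an inelastic collapse such that the sequence of collisions becomes eventually the infinite repetition of the pair of collisions $0$-$1$, $0$-$2$. The final angle $\overline\theta$ is the angle between the limits, as $t\to\tau^*$, of $x_1(t)-x_0(t)$ and $x_2(t)-x_0(t)$. *)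

theory Defs
  imports "HOL-Analysis.Analysis"
begin

text \<open>Particles are indexed by the three-element numeral type \<^typ>\<open>3\<close>, whose elements are
  \<open>0\<close>, \<open>1\<close>, \<open>2\<close>. A state is a pair (positions, velocities), carrying the Euclidean topology.\<close>

type_synonym 'd state = "(real^'d^3) \<times> (real^'d^3)"

abbreviation pos :: "'d::finite state \<Rightarrow> real^'d^3" where "pos \<equiv> fst"
abbreviation vel :: "'d::finite state \<Rightarrow> real^'d^3" where "vel \<equiv> snd"

definition phase_space :: "'d::finite state set" where
  "phase_space = {Z. \<forall>i j. i \<noteq> j \<longrightarrow> norm (pos Z $ i - pos Z $ j) \<ge> 1}"

definition in_contact :: "3 \<Rightarrow> 3 \<Rightarrow> real^'d::finite^3 \<Rightarrow> bool" where
  "in_contact i j x \<longleftrightarrow> i \<noteq> j \<and> norm (x $ i - x $ j) = 1"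

definition contact_dir :: "3 \<Rightarrow> 3 \<Rightarrow> real^'d::finite^3 \<Rightarrow> real^'d" where
  "contact_dir i j x = (x $ i - x $ j) /\<^sub>R norm (x $ i - x $ j)"

definition normal_velocity :: "3 \<Rightarrow> 3 \<Rightarrow> real^'d::finite^3 \<Rightarrow> real^'d^3 \<Rightarrow> real" where
  "normal_velocity i j x v = (v $ i - v $ j) \<bullet> contact_dir i j x"

definition collide :: "real \<Rightarrow> 3 \<Rightarrow> 3 \<Rightarrow> real^'d::finite^3 \<Rightarrow> real^'d^3 \<Rightarrow> real^'d^3" where
  "collide r i j x v = (\<chi> k.
     if k = i then v $ i - ((1 + r) / 2 * normal_velocity i j x v) *\<^sub>R contact_dir i j x
     else if k = j then v $ j + ((1 + r) / 2 * normal_velocity i j x v) *\<^sub>R contact_dir i j x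
     else v $ k)"

text \<open>Velocities are right-continuous along a trajectory: \<open>vel (Z s)\<close> is the velocity just after
  a collision at time \<open>s\<close>. The velocity just before \<open>s\<close> is the left limit for \<open>s > 0\<close> and the
  prescribed initial velocity for \<open>s = 0\<close>.\<close>

definition pre_velocity :: "'d::finite state \<Rightarrow> (real \<Rightarrow> 'd state) \<Rightarrow> real \<Rightarrow> real^'d^3 \<Rightarrow> bool" where
  "pre_velocity Z0 Z s u \<longleftrightarrow>
     (if s = 0 then u = vel Z0 else ((\<lambda>s. vel (Z s)) \<longlongrightarrow> u) (at_left s))"

text \<open>At a contact at time \<open>s > 0\<close> the particles are necessarily approaching (the trajectory stays
  in the phase space and grazing is excluded). Only at \<open>s = 0\<close> can a touching pair be separating,
  in which case it does not collide. With three particles, two distinct touching pairs always share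
  a particle, which is how triple collisions are excluded.\<close>

definition inelastic_trajectory ::
    "real \<Rightarrow> real \<Rightarrow> 'd::finite state \<Rightarrow> (real \<Rightarrow> 'd state) \<Rightarrow> bool" where
  "inelastic_trajectory r \<tau> Z0 Z \<longleftrightarrow>
     pos (Z 0) = pos Z0 \<and>
     (\<forall>s\<in>{0..<\<tau>}. Z s \<in> phase_space) \<and>
     continuous_on {0..<\<tau>} (\<lambda>s. pos (Z s)) \<and>
     (\<forall>a b. 0 \<le> a \<and> a < b \<and> b \<le> \<tau> \<and>
        (\<forall>s\<in>{a<..<b}. \<forall>i j. \<not> in_contact i j (pos (Z s))) \<longrightarrow>
        (\<forall>s\<in>{a..<b}. vel (Z s) = vel (Z a) \<and>
                     pos (Z s) = pos (Z a) + (s - a) *\<^sub>R vel (Z a))) \<and>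
     (\<forall>s\<in>{0..<\<tau>}. \<exists>u. pre_velocity Z0 Z s u \<and>
        (\<forall>i j. in_contact i j (pos (Z s)) \<longrightarrow>
           normal_velocity i j (pos (Z s)) u \<noteq> 0 \<and>
           (normal_velocity i j (pos (Z s)) u < 0 \<longrightarrow>
              vel (Z s) = collide r i j (pos (Z s)) u)) \<and>
        ((\<nexists>i j. in_contact i j (pos (Z s)) \<and> normal_velocity i j (pos (Z s)) u < 0) \<longrightarrow>
           vel (Z s) = u)) \<and>
     (\<forall>s\<in>{0..<\<tau>}. \<forall>i j k. in_contact i j (pos (Z s)) \<and> in_contact i k (pos (Z s)) \<longrightarrow> j = k)"

text \<open>The time \<open>t 0 = 0\<close> is the initial time, at which there need not be a collision.\<close>

definition inelastic_collapse ::
    "real \<Rightarrow> real \<Rightarrow> 'd::finite state \<Rightarrow> (real \<Rightarrow> 'd state) \<Rightarrow> (nat \<Rightarrow> real) \<Rightarrow> bool" where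
  "inelastic_collapse r \<tau> Z0 Z t \<longleftrightarrow>
     0 < \<tau> \<and> inelastic_trajectory r \<tau> Z0 Z \<and>
     strict_mono t \<and> t 0 = 0 \<and> t \<longlonglongrightarrow> \<tau> \<and>
     {s\<in>{0<..<\<tau>}. \<exists>i j. in_contact i j (pos (Z s))} = t ` {1..}"

text \<open>By the exclusion of triple collisions, the touching pair at time \<open>t n\<close> is unique, so it
  determines the type of the collision.\<close>

definition nearly_linear_collapse ::
    "real \<Rightarrow> real \<Rightarrow> 'd::finite state \<Rightarrow> (real \<Rightarrow> 'd state) \<Rightarrow> bool" where
  "nearly_linear_collapse r \<tau> Z0 Z \<longleftrightarrow>
     (\<exists>t. inelastic_collapse r \<tau> Z0 Z t \<and>
        (\<exists>N\<ge>1. \<forall>k. in_contact 0 1 (pos (Z (t (N + 2 * k)))) \<and>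
                   in_contact 0 2 (pos (Z (t (N + 2 * k + 1))))))"

definition vec_angle :: "'a::real_inner \<Rightarrow> 'a \<Rightarrow> real" where
  "vec_angle u v = arccos (u \<bullet> v / (norm u * norm v))"

definition has_final_angle :: "real \<Rightarrow> (real \<Rightarrow> 'd::finite state) \<Rightarrow> real \<Rightarrow> bool" where
  "has_final_angle \<tau> Z \<theta> \<longleftrightarrow>
     (\<exists>y1 y2. ((\<lambda>s. pos (Z s) $ 1 - pos (Z s) $ 0) \<longlongrightarrow> y1) (at_left \<tau>) \<and>
              ((\<lambda>s. pos (Z s) $ 2 - pos (Z s) $ 0) \<longlongrightarrow> y2) (at_left \<tau>) \<and>
              \<theta> = vec_angle y1 y2)"

definition r_stabi :: real where
  "r_stabi = 9 - 4 * sqrt 5"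

end

theory Submission
  imports Defs
begin

text \<open>Work in the frame of particle \<open>0\<close>. Let \<open>X\<close>, \<open>V\<close> be the relative position and velocity of the
  particle that particle \<open>0\<close> hits next, and \<open>Y\<close>, \<open>U\<close> those of the one hit last. Measuring gaps by
  \<open>((norm X)\<^sup>2 - 1) / 2\<close> makes free flight exactly quadratic in time and keeps the collision law
  exact in terms of \<open>q = - (X \<bullet> V)\<close> and \<open>p = Y \<bullet> U\<close>. With the geometry frozen and
  \<open>a = - cos \<theta>\<^sub>0 * (1 + r) / 2\<close>, one collision maps \<open>(p, q)\<close> to \<open>(r * q, a * q - p)\<close> with the roles of
  the outer particles exchanged, and multiplies the gap by \<open>p / q\<close>. If \<open>p \<le> S * q\<close> then the new \<open>q\<close> is at
  least \<open>(a - S) * q\<close>, so the bound on \<open>p / q\<close> persists when \<open>r < S * (a - S)\<close>, and \<open>gap / q\<^sup>2\<close>, which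
  controls the centrifugal correction to the frozen dynamics, does not grow when \<open>S < (a - S)\<^sup>2\<close>.
  Such an \<open>S\<close> exists precisely when \<open>a > root 3 r + (root 3 r)\<^sup>2\<close>, the hypothesis on \<open>\<theta>\<^sub>0\<close>. These
  inequalities being strict, they survive small perturbations and define a region, with interior,
  mapped into itself by each collision; there \<open>q\<close>, hence the flight times and the drift of
  \<open>X\<close> and \<open>Y\<close>, decay geometrically.\<close>

section \<open>One collision\<close>

text \<open>Twice the drift-free hitting time \<open>g / q\<close> is long enough: there the
  quadratic equals \<open>g * (2 * K * g - q^2) / q^2\<close>, which is negative, so the
  intermediate value theorem gives a root. In use \<open>K\<close> is the squared relative speed;
  that no contact occurs earlier is shown in \<open>region_step\<close>.\<close>

lemma quadratic_first_root:
  fixes g q K :: real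
  assumes "g > 0" "q > 0" "2 * K * g < q\<^sup>2"
  obtains \<tau> where "0 < \<tau>" "\<tau> \<le> 2 * g / q" "g - q * \<tau> + K * \<tau>\<^sup>2 / 2 = 0"
proof -
  define \<phi> where "\<phi> s = g - q * s + K * s\<^sup>2 / 2" for s
  have "\<phi> (2 * g / q) = g * (2 * K * g - q\<^sup>2) / q\<^sup>2"
    using assms by (simp add: \<phi>_def field_simps power2_eq_square)
  also have "\<dots> \<le> 0"
    using assms by (intro divide_nonpos_pos mult_nonneg_nonpos) auto
  finally have end_le: "\<phi> (2 * g / q) \<le> 0" .
  have "\<exists>\<tau>\<ge>0. \<tau> \<le> 2 * g / q \<and> \<phi> \<tau> = 0"
  proof (rule IVT2')
    show "continuous_on {0..2 * g / q} \<phi>"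
      unfolding \<phi>_def by (intro continuous_intros) auto
  qed (use assms end_le in \<open>auto simp: \<phi>_def\<close>)
  then obtain \<tau> where \<tau>: "\<tau> \<ge> 0" "\<tau> \<le> 2 * g / q" "\<phi> \<tau> = 0" by blast
  moreover have "\<tau> \<noteq> 0" using \<tau> assms by (auto simp: \<phi>_def)
  ultimately show ?thesis using that[of \<tau>] by (auto simp: \<phi>_def)
qed

locale collapse_region =
  fixes r S y a \<kappa> \<alpha> C W D \<epsilon> \<delta> :: real
  assumes r: "0 < r" "r < 1"
    and S: "0 < S" "S < 1"
    and y: "0 < y" "y + 2 * \<kappa> \<le> a - S" "r \<le> S * y" "S + \<kappa> \<le> y\<^sup>2"
    and \<kappa>: "0 < \<kappa>" "\<kappa> < a" "a + \<kappa> \<le> \<alpha>" "\<alpha> < 1"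
    and C: "0 < C" "2 \<le> C * (1 - \<alpha>)"
    and W: "0 < W"
    and D: "0 < D" "2 * W * \<epsilon> \<le> D * (1 - \<alpha>)"
    and \<epsilon>: "0 < \<epsilon>" "4 * W\<^sup>2 * \<epsilon> \<le> \<kappa>"
    and \<delta>: "0 < \<delta>" "\<delta> \<le> 1" "3 * \<delta> \<le> \<kappa>"
begin

definition centre :: "'a::real_inner \<Rightarrow> 'a \<Rightarrow> bool" where
  "centre e f \<longleftrightarrow> norm e = 1 \<and> norm f = 1 \<and> (1 + r) / 2 * (e \<bullet> f) = - a"

text \<open>A collision changes velocities, and the following flight changes positions, by \<open>O(q)\<close>, while \<open>q\<close>
  shrinks by the factor \<open>\<alpha>\<close>; adding \<open>C * q\<close> and \<open>D * q\<close> turns the resulting geometric sums into bounds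
  that are preserved in a single step. A positive gap of the particle last hit is allowed so
  that the region contains an open set of initial states, which need not come from a collision.\<close>

definition region :: "'a::real_inner \<Rightarrow> 'a \<Rightarrow> 'a \<Rightarrow> 'a \<Rightarrow> 'a \<Rightarrow> 'a \<Rightarrow> bool" where
  "region e f X V Y U \<longleftrightarrow>
     0 < - (X \<bullet> V) \<and> 0 < Y \<bullet> U \<and> Y \<bullet> U \<le> S * - (X \<bullet> V) \<and>
     1 < (norm X)\<^sup>2 \<and> 1 \<le> (norm Y)\<^sup>2 \<and>
     ((norm Y)\<^sup>2 - 1) / 2 + S * (((norm X)\<^sup>2 - 1) / 2) \<le> S * \<epsilon> * (X \<bullet> V)\<^sup>2 \<and>
     norm V + C * - (X \<bullet> V) \<le> W \<and> norm U + C * - (X \<bullet> V) \<le> W \<and>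
     norm (X - e) + D * - (X \<bullet> V) \<le> \<delta> \<and> norm (Y - f) + D * - (X \<bullet> V) \<le> \<delta>"

lemma centre_sym: "centre e f \<Longrightarrow> centre f e"
  by (auto simp: centre_def inner_commute)

text \<open>Bilinearity splits the error into two terms; since \<open>norm Y \<le> 2\<close> they
  add up to at most \<open>3 * \<delta>\<close>, which the margin \<open>\<kappa>\<close>
  covers.\<close>

lemma near_centre_inner:
  assumes "centre e f" "norm (X - e) \<le> \<delta>" "norm (Y - f) \<le> \<delta>"
  shows "\<bar>(1 + r) / 2 * (X \<bullet> Y) + a\<bar> \<le> \<kappa>"
proof -
  have "norm Y \<le> norm (Y - f) + norm f" by (metis diff_add_cancel norm_triangle_ineq)
  then have nY: "norm Y \<le> 2" using assms \<delta> by (auto simp: centre_def)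
  have "X \<bullet> Y - e \<bullet> f = (X - e) \<bullet> Y + e \<bullet> (Y - f)"
    by (simp add: algebra_simps)
  then have "\<bar>X \<bullet> Y - e \<bullet> f\<bar> \<le> \<bar>(X - e) \<bullet> Y\<bar> + \<bar>e \<bullet> (Y - f)\<bar>"
    by linarith
  also have "\<dots> \<le> norm (X - e) * norm Y + norm e * norm (Y - f)"
    by (intro add_mono Cauchy_Schwarz_ineq2)
  also have "\<dots> \<le> \<delta> * 2 + 1 * \<delta>"
    using assms nY \<delta> by (intro add_mono mult_mono) (auto simp: centre_def)
  finally have *: "\<bar>X \<bullet> Y - e \<bullet> f\<bar> \<le> \<kappa>" using \<delta> by simp
  have "(1 + r) / 2 * (X \<bullet> Y) + a = (1 + r) / 2 * (X \<bullet> Y - e \<bullet> f)"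
    using assms(1) by (simp add: centre_def algebra_simps)
  then have "\<bar>(1 + r) / 2 * (X \<bullet> Y) + a\<bar> = (1 + r) / 2 * \<bar>X \<bullet> Y - e \<bullet> f\<bar>"
    using r by (simp only: abs_mult) simp
  also have "\<dots> \<le> 1 * \<kappa>"
    using * r by (intro mult_mono) auto
  finally show ?thesis by simp
qed

text \<open>Since \<open>\<kappa> < a\<close>, the angle at particle \<open>0\<close> stays obtuse,
  so the squared distance of the outer particles exceeds \<open>2\<close>. This rules out collisions
  of type 1-2.\<close>

lemma near_centre_far_apart:
  assumes "centre e f" "norm (X - e) \<le> \<delta>" "norm (Y - f) \<le> \<delta>" "1 \<le> (norm X)\<^sup>2" "1 \<le> (norm Y)\<^sup>2"
  shows "1 < norm (X - Y)"
proof -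
  have "(1 + r) / 2 * (X \<bullet> Y) < 0"
    using near_centre_inner[OF assms(1-3)] \<kappa> by linarith
  then have "X \<bullet> Y < 0" using r by (simp add: mult_less_0_iff)
  moreover have "(norm (X - Y))\<^sup>2 = (norm X)\<^sup>2 + (norm Y)\<^sup>2 - 2 * (X \<bullet> Y)"
    by (simp add: power2_norm_eq_inner algebra_simps inner_commute)
  ultimately have "(norm (X - Y))\<^sup>2 > 1\<^sup>2" using assms by simp
  then show ?thesis by (rule power2_less_imp_less) simp
qed

lemma region_D:
  assumes "region e f X V Y U"
  shows "norm V \<le> W" "norm U \<le> W" "norm (X - e) \<le> \<delta>" "norm (Y - f) \<le> \<delta>"
    "1 < (norm X)\<^sup>2" "1 \<le> (norm Y)\<^sup>2"
proof -
  have "0 < - (X \<bullet> V)" using assms by (auto simp: region_def)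
  then have "0 \<le> C * - (X \<bullet> V)" "0 \<le> D * - (X \<bullet> V)"
    using C D by (simp_all only: mult_nonneg_nonneg less_imp_le)
  then show "norm V \<le> W" "norm U \<le> W" "norm (X - e) \<le> \<delta>" "norm (Y - f) \<le> \<delta>"
    "1 < (norm X)\<^sup>2" "1 \<le> (norm Y)\<^sup>2"
    using assms unfolding region_def by linarith+
qed

lemma norm_flight: "(norm (X + s *\<^sub>R V))\<^sup>2 = (norm X)\<^sup>2 + 2 * s * (X \<bullet> V) + (norm V)\<^sup>2 * s\<^sup>2"
  for X V :: "'a::real_inner"
  unfolding power2_norm_eq_inner
  by (simp add: inner_add_left inner_add_right inner_commute power2_eq_square algebra_simps)

text \<open>One free flight up to contact, followed by one collision. Particle \<open>0\<close>
  takes half of the change in its velocity relative to the particle hit, so \<open>V\<close> changes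
  by \<open>2 * c\<close> times \<open>X'\<close> and \<open>U\<close> by \<open>c\<close> times
  \<open>X'\<close>. The region is then recovered with the two outer particles exchanged.\<close>

lemma region_step:
  fixes e f X V Y U :: "'a::real_inner"
  assumes c: "centre e f" and reg: "region e f X V Y U"
  obtains \<tau> where "0 < \<tau>" "\<tau> \<le> 2 * \<epsilon> * - (X \<bullet> V)" "norm (X + \<tau> *\<^sub>R V) = 1"
    "(X + \<tau> *\<^sub>R V) \<bullet> V < 0"
    "\<And>s. 0 \<le> s \<Longrightarrow> s < \<tau> \<Longrightarrow> (norm (X + s *\<^sub>R V))\<^sup>2 > 1"
    "\<And>s. 0 < s \<Longrightarrow> (norm (Y + s *\<^sub>R U))\<^sup>2 > 1"
    "\<And>s. 0 \<le> s \<Longrightarrow> s \<le> \<tau> \<Longrightarrow> norm (X + s *\<^sub>R V - e) \<le> \<delta> \<and> norm (Y + s *\<^sub>R U - f) \<le> \<delta>"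
    "\<And>X' Y' V' U' c. X' = X + \<tau> *\<^sub>R V \<Longrightarrow> Y' = Y + \<tau> *\<^sub>R U \<Longrightarrow> c = (1 + r) / 2 * (X' \<bullet> V) \<Longrightarrow>
       V' = V - (2 * c) *\<^sub>R X' \<Longrightarrow> U' = U - c *\<^sub>R X' \<Longrightarrow>
       region f e Y' U' X' V' \<and> - (Y' \<bullet> U') \<le> \<alpha> * - (X \<bullet> V)"
proof -
  define q p g b where "q = - (X \<bullet> V)" and "p = Y \<bullet> U"
    and "g = ((norm X)\<^sup>2 - 1) / 2" and "b = ((norm Y)\<^sup>2 - 1) / 2"
  \<comment> \<open>The flight lasts at most \<open>2 * \<epsilon> * q\<close>, so
    \<open>\<theta> * q\<close> bounds the centrifugal change of \<open>q\<close> and of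
    \<open>p\<close> during it.\<close>
  define \<theta> where "\<theta> = 2 * W\<^sup>2 * \<epsilon>"
  have \<theta>: "0 < \<theta>" "2 * \<theta> \<le> \<kappa>" using \<epsilon> W by (auto simp: \<theta>_def)
  have q: "q > 0" and p: "0 < p" "p \<le> S * q" and g: "g > 0" and b: "b \<ge> 0"
    and bg: "b + S * g \<le> S * \<epsilon> * q\<^sup>2"
    and V: "norm V + C * q \<le> W" and U: "norm U + C * q \<le> W"
    and X: "norm (X - e) + D * q \<le> \<delta>" and Y: "norm (Y - f) + D * q \<le> \<delta>"
    using reg by (auto simp: region_def q_def p_def g_def b_def)
  have nV: "norm V \<le> W" and nU: "norm U \<le> W" using region_D[OF reg] by auto
  have V2: "(norm V)\<^sup>2 \<le> W\<^sup>2" and U2: "(norm U)\<^sup>2 \<le> W\<^sup>2" using nV nU by (auto intro: power_mono)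
  have "S * g \<le> S * (\<epsilon> * q\<^sup>2)" using bg b by (simp add: mult_ac)
  then have geps: "g \<le> \<epsilon> * q\<^sup>2" using S by simp
  have \<kappa>1: "\<kappa> < 1" using \<kappa> by linarith
  have "2 * (norm V)\<^sup>2 * g \<le> 2 * W\<^sup>2 * (\<epsilon> * q\<^sup>2)"
    using V2 geps g by (intro mult_mono) auto
  also have "\<dots> = \<theta> * q\<^sup>2" by (simp add: \<theta>_def)
  also have "\<dots> < 1 * q\<^sup>2" using \<theta> \<kappa>1 q by (intro mult_strict_right_mono) auto
  finally have disc: "2 * (norm V)\<^sup>2 * g < q\<^sup>2" by simp
  obtain \<tau> where \<tau>: "0 < \<tau>" "\<tau> \<le> 2 * g / q" and root: "g - q * \<tau> + (norm V)\<^sup>2 * \<tau>\<^sup>2 / 2 = 0"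
    using quadratic_first_root[OF g q disc] .
  have "2 * g / q \<le> 2 * (\<epsilon> * q\<^sup>2) / q" using geps q by (intro divide_right_mono) auto
  also have "\<dots> = 2 * \<epsilon> * q" using q by (simp add: power2_eq_square)
  finally have \<tau>q: "\<tau> \<le> 2 * \<epsilon> * q" using \<tau> by linarith
  have V\<tau>: "(norm V)\<^sup>2 * \<tau> \<le> \<theta> * q"
  proof -
    have "(norm V)\<^sup>2 * \<tau> \<le> W\<^sup>2 * (2 * \<epsilon> * q)" using V2 \<tau>q \<tau> by (intro mult_mono) auto
    then show ?thesis by (simp add: \<theta>_def mult_ac)
  qed
  have U\<tau>: "(norm U)\<^sup>2 * \<tau> \<le> \<theta> * q"
  proof -
    have "(norm U)\<^sup>2 * \<tau> \<le> W\<^sup>2 * (2 * \<epsilon> * q)" using U2 \<tau>q \<tau> by (intro mult_mono) auto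
    then show ?thesis by (simp add: \<theta>_def mult_ac)
  qed
  have \<theta>q: "\<theta> * q < q" using \<theta> \<kappa>1 q by simp
  define q1 p1 where "q1 = q - (norm V)\<^sup>2 * \<tau>" and "p1 = p + (norm U)\<^sup>2 * \<tau>"
  have q1: "0 < q1" "q1 \<le> q" "q - \<theta> * q \<le> q1"
    using V\<tau> \<theta>q \<tau> by (auto simp: q1_def)
  have p1: "p \<le> p1" "p1 \<le> S * q + \<theta> * q"
    using U\<tau> p \<tau> by (auto simp: p1_def)
  have X1: "(X + \<tau> *\<^sub>R V) \<bullet> V = - q1"
    by (simp add: q1_def q_def inner_add_left power2_norm_eq_inner)
  have Y1: "(Y + \<tau> *\<^sub>R U) \<bullet> U = p1"
    by (simp add: p1_def p_def inner_add_left power2_norm_eq_inner)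
  have "(norm (X + \<tau> *\<^sub>R V))\<^sup>2 = 1 + 2 * (g - q * \<tau> + (norm V)\<^sup>2 * \<tau>\<^sup>2 / 2)"
    by (simp add: norm_flight g_def q_def algebra_simps) (simp add: field_simps)
  then have nX1: "norm (X + \<tau> *\<^sub>R V) = 1" using root by (simp add: power2_eq_1_iff) (smt (verit) norm_ge_zero)
  \<comment> \<open>Subtracting the equation of the root factors out \<open>\<tau> - s\<close>; the
    other factor is positive because \<open>(norm V)^2 * \<tau> < q\<close>. Hence
    \<open>\<tau>\<close> is the first contact.\<close>
  have flightX: "(norm (X + s *\<^sub>R V))\<^sup>2 > 1" if "0 \<le> s" "s < \<tau>" for s
  proof -
    have "(norm (X + s *\<^sub>R V))\<^sup>2 - 1 = 2 * (g - q * s + (norm V)\<^sup>2 * s\<^sup>2 / 2)"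
      by (simp add: norm_flight g_def q_def algebra_simps) (simp add: field_simps)
    also have "\<dots> = 2 * ((g - q * s + (norm V)\<^sup>2 * s\<^sup>2 / 2) - (g - q * \<tau> + (norm V)\<^sup>2 * \<tau>\<^sup>2 / 2))"
      using root by simp
    also have "\<dots> = (\<tau> - s) * (2 * q - (norm V)\<^sup>2 * (\<tau> + s))"
      by (simp add: field_simps power2_eq_square)
    also have "\<dots> > 0"
    proof (intro mult_pos_pos)
      have "(norm V)\<^sup>2 * (\<tau> + s) \<le> (norm V)\<^sup>2 * (\<tau> + \<tau>)" using that by (intro mult_left_mono) auto
      then show "0 < 2 * q - (norm V)\<^sup>2 * (\<tau> + s)" using V\<tau> \<theta>q unfolding distrib_left by linarith
    qed (use that in auto)
    finally show ?thesis by simp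
  qed
  have flightY: "(norm (Y + s *\<^sub>R U))\<^sup>2 > 1" if "0 < s" for s
  proof -
    have "(norm (Y + s *\<^sub>R U))\<^sup>2 = 1 + 2 * b + 2 * s * p + (norm U)\<^sup>2 * s\<^sup>2"
      by (simp add: norm_flight b_def p_def field_simps)
    moreover have "2 * s * p > 0" using that p by simp
    moreover have "(norm U)\<^sup>2 * s\<^sup>2 \<ge> 0" by simp
    ultimately show ?thesis using b by linarith
  qed
  have drift: "norm (A + s *\<^sub>R B - h) \<le> norm (A - h) + 2 * W * \<epsilon> * q"
    if "0 \<le> s" "s \<le> \<tau>" "norm B \<le> W" for A B h :: 'a and s
  proof -
    have "norm (A + s *\<^sub>R B - h) \<le> norm (A - h) + norm (s *\<^sub>R B)"
      by (metis add_diff_eq add.commute diff_diff_eq2 norm_triangle_ineq diff_add_eq)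
    moreover have "norm (s *\<^sub>R B) \<le> (2 * \<epsilon> * q) * W"
      using that \<tau>q by (auto intro!: mult_mono)
    ultimately show ?thesis by (simp add: mult_ac)
  qed
  \<comment> \<open>The drift of positions in one flight is paid for by the decrease of
    \<open>D * q\<close> when \<open>q\<close> shrinks to at most \<open>\<alpha> * q\<close>. In
    the same way \<open>C'\<close> below pays for velocity jumps of size at most
    \<open>2 * q\<close>.\<close>
  have D': "2 * W * \<epsilon> * q \<le> D * q - D * (\<alpha> * q)"
  proof -
    have "2 * W * \<epsilon> * q \<le> D * (1 - \<alpha>) * q" using D q by (intro mult_right_mono) auto
    then show ?thesis by (simp add: algebra_simps)
  qed
  have \<alpha>0: "0 < \<alpha>" using \<kappa> by linarith
  have D0: "0 \<le> D * (\<alpha> * q)" using D \<alpha>0 q by simp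
  have near: "norm (X + s *\<^sub>R V - e) + D * (\<alpha> * q) \<le> \<delta>" "norm (Y + s *\<^sub>R U - f) + D * (\<alpha> * q) \<le> \<delta>"
    if "0 \<le> s" "s \<le> \<tau>" for s
    using drift[OF that nV, of X e] drift[OF that nU, of Y f] X Y D' by linarith+
  have near': "norm (X + s *\<^sub>R V - e) \<le> \<delta> \<and> norm (Y + s *\<^sub>R U - f) \<le> \<delta>"
    if "0 \<le> s" "s \<le> \<tau>" for s
    using near[OF that] D0 by linarith
  have step: "region f e Y' U' X' V' \<and> - (Y' \<bullet> U') \<le> \<alpha> * q"
    if X': "X' = X + \<tau> *\<^sub>R V" and Y': "Y' = Y + \<tau> *\<^sub>R U" and c': "c = (1 + r) / 2 * (X' \<bullet> V)"
      and V': "V' = V - (2 * c) *\<^sub>R X'" and U': "U' = U - c *\<^sub>R X'" for X' Y' V' U' c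
  proof -
    define a1 where "a1 = - ((1 + r) / 2 * (X' \<bullet> Y'))"
    have "\<bar>(1 + r) / 2 * (X' \<bullet> Y') + a\<bar> \<le> \<kappa>"
      using near_centre_inner[OF assms(1)] near'[of \<tau>] \<tau> unfolding X' Y' by auto
    then have a1: "a - \<kappa> \<le> a1" "a1 \<le> \<alpha>" "0 < a1" "a1 < 1" using \<kappa> by (auto simp: a1_def)
    have c1: "c = - ((1 + r) / 2 * q1)" using X1 by (simp add: c' X')
    have "X' \<bullet> V' = X' \<bullet> V - 2 * c * (norm X')\<^sup>2"
      by (simp add: V' inner_diff_right power2_norm_eq_inner)
    \<comment> \<open>The normal velocity is reversed and multiplied by \<open>r\<close>: the new
      \<open>p\<close> is \<open>r * q1\<close>.\<close>
    then have pp: "X' \<bullet> V' = r * q1" using nX1 X1 by (simp add: X' c1 field_simps)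
    define q2 where "q2 = - (Y' \<bullet> U')"
    have "Y' \<bullet> U = p1" using Y1 by (simp add: Y')
    then have "Y' \<bullet> U' = p1 - c * (X' \<bullet> Y')"
      by (simp add: U' inner_diff_right inner_commute[of Y' X'])
    then have q2: "q2 = a1 * q1 - p1"
      by (simp add: q2_def a1_def c1 field_simps)
    have "a1 * q1 \<le> \<alpha> * q" using a1 q1 \<alpha>0 by (intro mult_mono) auto
    then have q2\<alpha>: "q2 \<le> \<alpha> * q" using q2 p p1 by linarith
    \<comment> \<open>Collecting the losses in \<open>q2 = a1 * q1 - p1\<close>:
      \<open>\<kappa>\<close> from the geometry, \<open>\<theta>\<close> from the flight of the
      incoming particle, \<open>S + \<theta>\<close> from \<open>p1\<close>. As
      \<open>2 * \<theta> \<le> \<kappa>\<close>, at least \<open>a - S - 2 * \<kappa>\<close>,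
      hence \<open>y\<close>, remains.\<close>
    have "a1 * (q - \<theta> * q) \<le> a1 * q1" using a1 q1 by (intro mult_left_mono) auto
    moreover have "a1 * (\<theta> * q) \<le> 1 * (\<theta> * q)" using a1 \<theta> q by (intro mult_right_mono) auto
    moreover have "(a - \<kappa>) * q \<le> a1 * q" using a1 q by (intro mult_right_mono) auto
    ultimately have "(a - \<kappa> - \<theta> - S - \<theta>) * q \<le> q2"
      using q2 p1 by (simp add: algebra_simps)
    moreover have "y * q \<le> (a - \<kappa> - \<theta> - S - \<theta>) * q"
      using y \<theta> q by (intro mult_right_mono) auto
    ultimately have yq: "y * q \<le> q2" by linarith
    then have q2pos: "0 < q2" using y q by (smt (verit) mult_pos_pos)
    have "r * q1 \<le> (S * y) * q" using r q1 y S by (intro mult_mono) auto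
    also have "\<dots> \<le> S * q2" using yq S by (simp add: mult.assoc)
    finally have pS: "r * q1 \<le> S * q2" .
    have \<tau>2: "\<tau>\<^sup>2 \<le> (2 * \<epsilon> * q)\<^sup>2" using \<tau> \<tau>q by (intro power_mono) auto
    have WT: "W\<^sup>2 * \<tau>\<^sup>2 / 2 \<le> \<epsilon> * q\<^sup>2 * \<theta>"
    proof -
      have "W\<^sup>2 * \<tau>\<^sup>2 / 2 \<le> W\<^sup>2 * (2 * \<epsilon> * q)\<^sup>2 / 2" using \<tau>2 by (simp add: mult_left_mono)
      also have "\<dots> = \<epsilon> * q\<^sup>2 * \<theta>" by (simp add: \<theta>_def power2_eq_square)
      finally show ?thesis .
    qed
    have gap: "((norm Y')\<^sup>2 - 1) / 2 = b + \<tau> * p + (norm U)\<^sup>2 * \<tau>\<^sup>2 / 2"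
      by (simp add: Y' norm_flight b_def p_def field_simps)
    \<comment> \<open>The root equation trades the flight time for the old gap:
      \<open>\<tau> * p \<le> S * q * \<tau>\<close> is \<open>S * g\<close> up to second order.
      This is why the region bounds the weighted sum \<open>b + S * g\<close>, which dominates the
      new gap up to an error absorbed by \<open>S + 2 * \<theta> \<le> y^2\<close>.\<close>
    have q\<tau>: "q * \<tau> = g + (norm V)\<^sup>2 * \<tau>\<^sup>2 / 2" using root by linarith
    have "\<tau> * p \<le> S * (q * \<tau>)" using p \<tau> mult_left_mono[of p "S * q" \<tau>] by (simp add: mult_ac)
    also have "\<dots> = S * g + S * ((norm V)\<^sup>2 * \<tau>\<^sup>2 / 2)"
      unfolding q\<tau> by (rule distrib_left)
    also have "S * ((norm V)\<^sup>2 * \<tau>\<^sup>2 / 2) \<le> 1 * (W\<^sup>2 * \<tau>\<^sup>2 / 2)"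
      using S V2 by (intro mult_mono divide_right_mono) auto
    finally have "\<tau> * p \<le> S * g + W\<^sup>2 * \<tau>\<^sup>2 / 2" by simp
    moreover have "(norm U)\<^sup>2 * \<tau>\<^sup>2 / 2 \<le> W\<^sup>2 * \<tau>\<^sup>2 / 2"
      using U2 by (intro divide_right_mono mult_right_mono) auto
    ultimately have "((norm Y')\<^sup>2 - 1) / 2 \<le> S * \<epsilon> * q\<^sup>2 + 2 * (\<epsilon> * q\<^sup>2 * \<theta>)"
      using bg WT unfolding gap by linarith
    also have "\<dots> = (\<epsilon> * q\<^sup>2) * (S + 2 * \<theta>)" by (simp add: algebra_simps)
    also have "\<dots> \<le> (\<epsilon> * q\<^sup>2) * y\<^sup>2" using \<epsilon> \<theta> y by (intro mult_left_mono) auto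
    also have "\<dots> = \<epsilon> * (y * q)\<^sup>2" by (simp add: power_mult_distrib)
    also have "\<dots> \<le> \<epsilon> * q2\<^sup>2" using yq y q \<epsilon> by (intro mult_left_mono power_mono) auto
    finally have gap2: "((norm Y')\<^sup>2 - 1) / 2 \<le> \<epsilon> * q2\<^sup>2" .
    have C': "C * q2 + 2 * q \<le> C * q"
    proof -
      have "C * q2 \<le> C * (\<alpha> * q)" using q2\<alpha> C by simp
      moreover have "2 * q \<le> C * (1 - \<alpha>) * q" using C q by (intro mult_right_mono) auto
      ultimately show ?thesis by (simp add: algebra_simps)
    qed
    have cq: "\<bar>c\<bar> \<le> q"
    proof -
      have "\<bar>c\<bar> = (1 + r) / 2 * q1" using r q1 by (simp add: c1)
      also have "\<dots> \<le> 1 * q" using r q1 by (intro mult_mono) auto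
      finally show ?thesis by simp
    qed
    have "norm V' \<le> norm V + norm ((2 * c) *\<^sub>R X')" unfolding V' by (rule norm_triangle_ineq4)
    moreover have "norm U' \<le> norm U + norm (c *\<^sub>R X')" unfolding U' by (rule norm_triangle_ineq4)
    ultimately have "norm V' \<le> norm V + 2 * q" "norm U' \<le> norm U + 2 * q"
      using nX1 cq by (auto simp: X')
    then have nVU: "norm V' + C * q2 \<le> W" "norm U' + C * q2 \<le> W"
      using C' V U by linarith+
    have "D * q2 \<le> D * (\<alpha> * q)" using q2\<alpha> D by simp
    then have nXY: "norm (X' - e) + D * q2 \<le> \<delta>" "norm (Y' - f) + D * q2 \<le> \<delta>"
      using near[of \<tau>] \<tau> unfolding X' Y' by linarith+
    have "region f e Y' U' X' V'"
      unfolding region_def q2_def[symmetric] pp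
    proof (intro conjI)
      show "1 < (norm Y')\<^sup>2" using flightY[OF \<tau>(1)] by (simp add: Y')
      show "((norm X')\<^sup>2 - 1) / 2 + S * (((norm Y')\<^sup>2 - 1) / 2) \<le> S * \<epsilon> * (Y' \<bullet> U')\<^sup>2"
      proof -
        have "S * (((norm Y')\<^sup>2 - 1) / 2) \<le> S * (\<epsilon> * q2\<^sup>2)" using gap2 S by simp
        then show ?thesis using nX1 by (simp add: X' q2_def mult_ac)
      qed
    qed (use q2pos r q1 pS nVU nXY nX1 X' in auto)
    then show ?thesis using q2\<alpha> by (simp add: q2_def)
  qed
  show thesis
    by (rule that[of \<tau>])
      (use \<tau> \<tau>q nX1 X1 q1 flightX flightY near' step in \<open>auto simp: q_def\<close>)
qed

end

section \<open>Trajectories from collision sequences\<close>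

text \<open>Exchanging the pair flips the sign of the contact direction, which enters the law twice.
  It is needed because contacts are quantified over ordered pairs.\<close>

lemma collide_commute:
  assumes "i \<noteq> j"
  shows "collide r j i x v = collide r i j x v" "normal_velocity j i x v = normal_velocity i j x v"
proof -
  have d: "contact_dir j i x = - contact_dir i j x"
    by (simp add: contact_dir_def norm_minus_commute flip: scaleR_minus_right)
  show n: "normal_velocity j i x v = normal_velocity i j x v"
    by (simp add: normal_velocity_def d inner_diff_left)
  show "collide r j i x v = collide r i j x v"
    using assms by (auto simp: collide_def vec_eq_iff n d)
qed

text \<open>\<open>x n\<close> and \<open>v n\<close> are the state just after the collision at
  \<open>t n\<close> (for \<open>n = 0\<close> the initial state), and \<open>c n\<close> is the
  partner of particle \<open>0\<close> at time \<open>t (Suc n)\<close>. In \<open>apart\<close>,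
  the left end of a flight is included only for \<open>n = 0\<close>, since afterwards the pair that
  has just collided still touches there.\<close>

locale collision_sequence =
  fixes r \<tau> :: real and t :: "nat \<Rightarrow> real" and x v :: "nat \<Rightarrow> real^'d::finite^3" and c :: "nat \<Rightarrow> 3"
  assumes mono_t: "strict_mono t" and t0: "t 0 = 0" and lim_t: "t \<longlonglongrightarrow> \<tau>"
    and x_Suc: "x (Suc n) = x n + (t (Suc n) - t n) *\<^sub>R v n"
    and v_Suc: "v (Suc n) = collide r 0 (c n) (x (Suc n)) (v n)"
    and c0: "c n \<noteq> 0"
    and contact: "norm (x (Suc n) $ 0 - x (Suc n) $ c n) = 1"
    and others: "i \<noteq> j \<Longrightarrow> {i, j} \<noteq> {0, c n} \<Longrightarrow> norm (x (Suc n) $ i - x (Suc n) $ j) > 1"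
    and approach: "normal_velocity 0 (c n) (x (Suc n)) (v n) < 0"
    and apart: "t n \<le> s \<Longrightarrow> s < t (Suc n) \<Longrightarrow> n = 0 \<or> t n < s \<Longrightarrow> i \<noteq> j \<Longrightarrow>
      norm ((x n + (s - t n) *\<^sub>R v n) $ i - (x n + (s - t n) *\<^sub>R v n) $ j) > 1"
begin

text \<open>The strict inequality makes the flights half-open on the right, so that the velocity at
  a collision time is the outgoing one.\<close>

definition idx :: "real \<Rightarrow> nat" where "idx s = (LEAST n. s < t (Suc n))"

definition traj :: "real \<Rightarrow> 'd state" where
  "traj s = (x (idx s) + (s - t (idx s)) *\<^sub>R v (idx s), v (idx s))"

lemma t_less: "t n < \<tau>"
proof -
  have "t n < t (Suc n)" using mono_t by (simp add: strict_mono_less)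
  also have "\<dots> \<le> \<tau>"
    using mono_t lim_t by (intro incseq_le) (auto intro: strict_mono_mono)
  finally show ?thesis .
qed

lemma t_Suc: "t n < t (Suc n)" using mono_t by (simp add: strict_mono_less)

lemma t_nonneg: "0 \<le> t n" using mono_t t0 by (metis le0 strict_mono_less_eq)

lemma idx_eq: "t n \<le> s \<Longrightarrow> s < t (Suc n) \<Longrightarrow> idx s = n"
  unfolding idx_def
proof (rule Least_equality)
  fix m assume "t n \<le> s" "s < t (Suc m)"
  then have "t n < t (Suc m)" by linarith
  then show "n \<le> m" using mono_t by (simp add: strict_mono_less)
qed

lemma idx_exists:
  assumes "0 \<le> s" "s < \<tau>"
  obtains n where "t n \<le> s" "s < t (Suc n)"
proof -
  have "eventually (\<lambda>n. s < t n) sequentially" using lim_t assms(2) by (rule order_tendstoD)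
  then obtain N where N: "s < t N" by (auto simp: eventually_sequentially)
  define m where "m = (LEAST n. s < t n)"
  have m: "s < t m" unfolding m_def using N by (rule LeastI)
  have "m \<noteq> 0" using m t0 assms by (metis not_less)
  then obtain n where n: "m = Suc n" by (cases m) auto
  have "\<not> s < t n" using not_less_Least[of n "\<lambda>n. s < t n"] n by (simp add: m_def)
  then show ?thesis using that[of n] m n by auto
qed

lemma traj_eq: "t n \<le> s \<Longrightarrow> s < t (Suc n) \<Longrightarrow> traj s = (x n + (s - t n) *\<^sub>R v n, v n)"
  by (simp add: traj_def idx_eq)

lemma traj_t: "traj (t n) = (x n, v n)"
  using traj_eq[of n "t n"] t_Suc[of n] by simp

lemma pos_traj_closed: "t n \<le> s \<Longrightarrow> s \<le> t (Suc n) \<Longrightarrow> pos (traj s) = x n + (s - t n) *\<^sub>R v n"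
  using traj_eq[of n s] traj_t[of "Suc n"] by (cases "s = t (Suc n)") (auto simp: x_Suc)

lemma norm_contact: "norm (x (Suc n) $ i - x (Suc n) $ j) = 1" if "i \<noteq> j" "{i, j} = {0, c n}"
  using that contact[of n] by (auto simp: doubleton_eq_iff norm_minus_commute)

lemma in_contact_t: "in_contact i j (x (Suc n)) \<longleftrightarrow> i \<noteq> j \<and> {i, j} = {0, c n}"
  using others[of i j n] norm_contact[of i j n] unfolding in_contact_def by force

lemma not_contact_flight:
  "t n \<le> s \<Longrightarrow> s < t (Suc n) \<Longrightarrow> n = 0 \<or> t n < s \<Longrightarrow> \<not> in_contact i j (pos (traj s))"
  using apart[of n s i j] traj_eq[of n s] by (auto simp: in_contact_def)

lemma contact_times: "0 \<le> s \<Longrightarrow> s < \<tau> \<Longrightarrow> in_contact i j (pos (traj s)) \<Longrightarrow> \<exists>n. s = t (Suc n)"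
proof -
  assume s: "0 \<le> s" "s < \<tau>" and ct: "in_contact i j (pos (traj s))"
  obtain n where n: "t n \<le> s" "s < t (Suc n)" using idx_exists[OF s] .
  have "\<not> (n = 0 \<or> t n < s)" using not_contact_flight[OF n, of i j] ct by blast
  then have "n \<noteq> 0" "s = t n" using n by auto
  then show ?thesis by (metis not0_implies_Suc)
qed

lemma traj_phase_space:
  assumes "0 \<le> s" "s < \<tau>" shows "traj s \<in> phase_space"
proof -
  obtain n where n: "t n \<le> s" "s < t (Suc n)" using idx_exists[OF assms] .
  show ?thesis
  proof (cases "n = 0 \<or> t n < s")
    case True
    then show ?thesis using n apart[OF n True] by (auto simp: phase_space_def traj_eq intro: less_imp_le)
  next
    case False
    then obtain m where "n = Suc m" "s = t (Suc m)" using n by (metis not0_implies_Suc order_le_less)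
    moreover have "norm (x (Suc m) $ i - x (Suc m) $ j) \<ge> 1" if "i \<noteq> j" for i j
      using others[OF that, of m] norm_contact[OF that, of m] by force
    ultimately show ?thesis by (simp add: phase_space_def traj_t)
  qed
qed

text \<open>Finitely many closed flights are glued together, which covers \<open>{0..t n}\<close>;
  every time before \<open>\<tau>\<close> has a neighbourhood inside such an interval, because
  collisions accumulate only at \<open>\<tau>\<close>.\<close>

lemma continuous_pos_traj: "continuous_on {0..<\<tau>} (\<lambda>s. pos (traj s))"
proof -
  have *: "continuous_on {0..t n} (\<lambda>s. pos (traj s))" for n
  proof (induction n)
    case 0
    then show ?case by (simp add: t0)
  next
    case (Suc n)
    have "continuous_on {t n..t (Suc n)} (\<lambda>s. x n + (s - t n) *\<^sub>R v n)"
      by (intro continuous_intros)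
    then have "continuous_on {t n..t (Suc n)} (\<lambda>s. pos (traj s))"
      by (rule continuous_on_eq) (simp add: pos_traj_closed[of n])
    then have "continuous_on ({0..t n} \<union> {t n..t (Suc n)}) (\<lambda>s. pos (traj s))"
      using Suc by (intro continuous_on_closed_Un) auto
    also have "{0..t n} \<union> {t n..t (Suc n)} = {0..t (Suc n)}"
      using t_Suc[of n] t_nonneg[of n] by (intro ivl_disj_un_two_touch) auto
    finally show ?case .
  qed
  show ?thesis
    unfolding continuous_on_eq_continuous_within
  proof
    fix s assume s: "s \<in> {0..<\<tau>}"
    then obtain n where n: "t n \<le> s" "s < t (Suc n)" using idx_exists by auto
    have "at s within {0..<\<tau>} = at s within {0..t (Suc n)}"
      using n t_less[of "Suc n"] by (intro at_within_nhd[of s "{..<t (Suc n)}"]) auto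
    then show "continuous (at s within {0..<\<tau>}) (\<lambda>s. pos (traj s))"
      using *[of "Suc n"] s n by (simp add: continuous_on_eq_continuous_within continuous_within)
  qed
qed

lemma vel_traj_left:
  assumes "t n < s" "s \<le> t (Suc n)"
  shows "((\<lambda>s. vel (traj s)) \<longlongrightarrow> v n) (at_left s)"
proof (rule tendsto_eventually)
  have "eventually (\<lambda>u. u \<in> {t n<..<s}) (at_left s)"
    by (rule eventually_at_leftI[of "t n"]) (use assms in auto)
  then show "eventually (\<lambda>u. vel (traj u) = v n) (at_left s)"
    by eventually_elim (use assms in \<open>auto simp: traj_eq[of n]\<close>)
qed

text \<open>An open interval without contacts cannot contain the next collision time, so it lies
  within a single flight. Its left end may itself be a collision time, where \<open>traj\<close>
  already has the outgoing velocity.\<close>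

lemma traj_free_flight:
  assumes "0 \<le> a" "a < b" "b \<le> \<tau>"
    and free: "\<And>s i j. s \<in> {a<..<b} \<Longrightarrow> \<not> in_contact i j (pos (traj s))"
    and s: "s \<in> {a..<b}"
  shows "vel (traj s) = vel (traj a) \<and> pos (traj s) = pos (traj a) + (s - a) *\<^sub>R vel (traj a)"
proof -
  obtain n where n: "t n \<le> a" "a < t (Suc n)" using idx_exists[of a] assms by auto
  have "in_contact 0 (c n) (pos (traj (t (Suc n))))" using c0[of n] by (simp add: traj_t in_contact_t)
  then have "b \<le> t (Suc n)" using free[of "t (Suc n)"] n by force
  then have "traj s = (x n + (s - t n) *\<^sub>R v n, v n)" "traj a = (x n + (a - t n) *\<^sub>R v n, v n)"
    using n s by (auto intro: traj_eq)
  then show ?thesis by (simp add: algebra_simps)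
qed

lemma inelastic_trajectory: "inelastic_trajectory r \<tau> (x 0, v 0) traj"
  unfolding inelastic_trajectory_def
proof (intro conjI)
  show "pos (traj 0) = pos (x 0, v 0)" using traj_t[of 0] t0 by simp
  show "\<forall>s\<in>{0..<\<tau>}. traj s \<in> phase_space" using traj_phase_space by auto
  show "continuous_on {0..<\<tau>} (\<lambda>s. pos (traj s))" by (rule continuous_pos_traj)
  show "\<forall>a b. 0 \<le> a \<and> a < b \<and> b \<le> \<tau> \<and>
        (\<forall>s\<in>{a<..<b}. \<forall>i j. \<not> in_contact i j (pos (traj s))) \<longrightarrow>
        (\<forall>s\<in>{a..<b}. vel (traj s) = vel (traj a) \<and>
                     pos (traj s) = pos (traj a) + (s - a) *\<^sub>R vel (traj a))"
    by (intro allI impI ballI traj_free_flight) auto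
  show "\<forall>s\<in>{0..<\<tau>}. \<forall>i j k. in_contact i j (pos (traj s)) \<and> in_contact i k (pos (traj s)) \<longrightarrow> j = k"
  proof (intro ballI allI impI)
    fix s i j k assume s: "s \<in> {0..<\<tau>}" and *: "in_contact i j (pos (traj s)) \<and> in_contact i k (pos (traj s))"
    obtain n where "s = t (Suc n)" using s * contact_times[of s i j] by auto
    then show "j = k" using * by (auto simp: traj_t in_contact_t doubleton_eq_iff)
  qed
  show "\<forall>s\<in>{0..<\<tau>}. \<exists>u. pre_velocity (x 0, v 0) traj s u \<and>
        (\<forall>i j. in_contact i j (pos (traj s)) \<longrightarrow>
           normal_velocity i j (pos (traj s)) u \<noteq> 0 \<and>
           (normal_velocity i j (pos (traj s)) u < 0 \<longrightarrow>
              vel (traj s) = collide r i j (pos (traj s)) u)) \<and>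
        ((\<nexists>i j. in_contact i j (pos (traj s)) \<and> normal_velocity i j (pos (traj s)) u < 0) \<longrightarrow>
           vel (traj s) = u)"
  proof
    fix s assume s: "s \<in> {0..<\<tau>}"
    then obtain n where n: "t n \<le> s" "s < t (Suc n)" using idx_exists by auto
    show "\<exists>u. pre_velocity (x 0, v 0) traj s u \<and>
        (\<forall>i j. in_contact i j (pos (traj s)) \<longrightarrow>
           normal_velocity i j (pos (traj s)) u \<noteq> 0 \<and>
           (normal_velocity i j (pos (traj s)) u < 0 \<longrightarrow>
              vel (traj s) = collide r i j (pos (traj s)) u)) \<and>
        ((\<nexists>i j. in_contact i j (pos (traj s)) \<and> normal_velocity i j (pos (traj s)) u < 0) \<longrightarrow>
           vel (traj s) = u)"
    \<comment> \<open>Without contact the velocity before \<open>s\<close> is \<open>v n\<close>,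
      which at \<open>s = 0\<close> is the initial velocity. Otherwise \<open>s = t (Suc m)\<close>,
      and the left limit \<open>v m\<close> is the incoming velocity of the collision.\<close>
    proof (cases "n = 0 \<or> t n < s")
      case True
      have "pre_velocity (x 0, v 0) traj s (v n)"
      proof (cases "s = 0")
        case True
        then have "n = 0" using n t0 t_nonneg mono_t by (metis antisym strict_mono_eq)
        then show ?thesis using True by (simp add: pre_velocity_def)
      next
        case False
        then have "t n < s" using True s t0 by auto
        then show ?thesis using False n vel_traj_left[of n s] by (simp add: pre_velocity_def)
      qed
      then show ?thesis using not_contact_flight[OF n True] traj_eq[OF n] by auto
    next
      case False
      then obtain m where m: "n = Suc m" "s = t (Suc m)" using n by (metis not0_implies_Suc order_le_less)
      have "s \<noteq> 0" using m t_Suc[of m] t_nonneg[of m] by auto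
      then have "pre_velocity (x 0, v 0) traj s (v m)"
        using vel_traj_left[of m s] t_Suc[of m] m by (simp add: pre_velocity_def)
      moreover have "normal_velocity i j (x (Suc m)) (v m) < 0 \<and>
          v (Suc m) = collide r i j (x (Suc m)) (v m)" if "in_contact i j (x (Suc m))" for i j
      proof -
        have "(i, j) = (0, c m) \<or> (i, j) = (c m, 0)"
          using that by (auto simp: in_contact_t doubleton_eq_iff)
        then show ?thesis
          using approach[of m] v_Suc[of m] collide_commute[OF c0[of m]] by (metis prod.inject)
      qed
      moreover have "in_contact 0 (c m) (x (Suc m))" using c0[of m] by (simp add: in_contact_t)
      ultimately show ?thesis using m by (intro exI[of _ "v m"]) (auto simp: traj_t dest: less_imp_neq)
    qed
  qed
qed

lemma inelastic_collapse: "inelastic_collapse r \<tau> (x 0, v 0) traj t"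
  unfolding inelastic_collapse_def
proof (intro conjI inelastic_trajectory mono_t t0 lim_t)
  show "0 < \<tau>" using t_less[of 0] t0 by simp
  show "{s \<in> {0<..<\<tau>}. \<exists>i j. in_contact i j (pos (traj s))} = t ` {1..}" (is "?L = ?R")
  proof (intro equalityI subsetI)
    fix s assume "s \<in> ?L"
    then obtain i j where "0 \<le> s" "s < \<tau>" "in_contact i j (pos (traj s))" by auto
    then obtain n where "s = t (Suc n)" using contact_times[of s i j] by auto
    then show "s \<in> ?R" by auto
  next
    fix s assume "s \<in> ?R"
    then obtain n where n: "s = t (Suc n)" by (auto simp: Suc_le_eq gr0_conv_Suc)
    have "in_contact 0 (c n) (pos (traj s))" using c0[of n] by (simp add: n traj_t in_contact_t)
    then show "s \<in> ?L" using n t_less[of "Suc n"] t_Suc[of n] t_nonneg[of n] by force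
  qed
qed

lemma nearly_linear_collapse:
  assumes "\<And>n. c n = (if even n then 1 else 2)"
  shows "nearly_linear_collapse r \<tau> (x 0, v 0) traj"
  unfolding nearly_linear_collapse_def
\<comment> \<open>The repetition starts at \<open>N = 1\<close>: time \<open>t 0\<close> is no
  collision, and the partner at \<open>t (Suc n)\<close> is \<open>c n\<close>, so odd positions
  belong to particle \<open>1\<close>.\<close>
proof (intro exI[of _ t] conjI exI[of _ "1::nat"] allI inelastic_collapse)
  fix k
  show "in_contact 0 1 (pos (traj (t (1 + 2 * k))))"
    using assms[of "2 * k"] by (simp add: traj_t in_contact_t)
  show "in_contact 0 2 (pos (traj (t (1 + 2 * k + 1))))"
    using assms[of "2 * k + 1"] by (simp add: traj_t in_contact_t)
qed simp

text \<open>A bounded relative velocity makes the relative position Lipschitz in time. As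
  \<open>t\<close> converges, its values at collision times have a summable variation and hence a
  limit; the same Lipschitz bound carries the limit over to continuous time.\<close>

lemma relative_position_limit:
  assumes bound: "\<And>n. norm (v n $ i - v n $ j) \<le> W"
  obtains l where "((\<lambda>s. pos (traj s) $ i - pos (traj s) $ j) \<longlongrightarrow> l) (at_left \<tau>)"
    "(\<lambda>n. x n $ i - x n $ j) \<longlonglongrightarrow> l"
proof -
  define \<rho> where "\<rho> n = x n $ i - x n $ j" for n
  have \<rho>_flight: "(x n + h *\<^sub>R v n) $ i - (x n + h *\<^sub>R v n) $ j = \<rho> n + h *\<^sub>R (v n $ i - v n $ j)" for n h
    by (simp add: \<rho>_def algebra_simps)
  have lip1: "norm (\<rho> (Suc n) - \<rho> n) \<le> W * (t (Suc n) - t n)" for n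
  proof -
    have "\<rho> (Suc n) = \<rho> n + (t (Suc n) - t n) *\<^sub>R (v n $ i - v n $ j)"
      using \<rho>_flight[of n "t (Suc n) - t n"] by (simp add: \<rho>_def x_Suc)
    then have "norm (\<rho> (Suc n) - \<rho> n) = (t (Suc n) - t n) * norm (v n $ i - v n $ j)"
      using t_Suc[of n] by simp
    also have "\<dots> \<le> (t (Suc n) - t n) * W" using bound[of n] t_Suc[of n] by (intro mult_left_mono) auto
    finally show ?thesis by (simp add: mult.commute)
  qed
  have lip: "norm (\<rho> (n + k) - \<rho> n) \<le> W * (t (n + k) - t n)" for n k
  proof (induction k)
    case (Suc k)
    have "norm (\<rho> (n + Suc k) - \<rho> n) \<le> norm (\<rho> (Suc (n + k)) - \<rho> (n + k)) + norm (\<rho> (n + k) - \<rho> n)"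
      using norm_triangle_ineq[of "\<rho> (Suc (n + k)) - \<rho> (n + k)" "\<rho> (n + k) - \<rho> n"] by simp
    then show ?case using Suc lip1[of "n + k"] by (simp add: algebra_simps)
  qed simp
  have "summable (\<lambda>n. t (Suc n) - t n)" using lim_t by (auto intro: telescope_summable)
  then have "summable (\<lambda>n. W * (t (Suc n) - t n))" by (rule summable_mult)
  then have "summable (\<lambda>n. \<rho> (Suc n) - \<rho> n)"
    by (rule summable_comparison_test') (use lip1 in auto)
  then have "convergent (\<lambda>n. \<Sum>k<n. \<rho> (Suc k) - \<rho> k)" by (simp add: summable_iff_convergent)
  then obtain L where "(\<lambda>n. \<rho> n - \<rho> 0) \<longlonglongrightarrow> L" by (auto simp: convergent_def sum_lessThan_telescope)
  then have l: "\<rho> \<longlonglongrightarrow> L + \<rho> 0" (is "_ \<longlonglongrightarrow> ?l") using tendsto_add[of _ L _ "\<lambda>_. \<rho> 0"] by fastforce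
  have tail: "norm (?l - \<rho> n) \<le> W * (\<tau> - t n)" for n
  proof (rule LIMSEQ_le)
    show "(\<lambda>k. norm (\<rho> (k + n) - \<rho> n)) \<longlonglongrightarrow> norm (?l - \<rho> n)"
      by (intro tendsto_intros LIMSEQ_ignore_initial_segment l)
    show "(\<lambda>k. W * (t (k + n) - t n)) \<longlonglongrightarrow> W * (\<tau> - t n)"
      by (intro tendsto_intros LIMSEQ_ignore_initial_segment lim_t)
  qed (use lip[of n] in \<open>auto simp: add.commute\<close>)
  \<comment> \<open>Going back from the next collision, the two errors
    \<open>W * (\<tau> - t (Suc n))\<close> and \<open>W * (t (Suc n) - s)\<close> add up to the
    claim.\<close>
  have near: "norm (pos (traj s) $ i - pos (traj s) $ j - ?l) \<le> W * (\<tau> - s)" if "0 \<le> s" "s < \<tau>" for s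
  proof -
    obtain n where n: "t n \<le> s" "s < t (Suc n)" using idx_exists[OF \<open>0 \<le> s\<close> \<open>s < \<tau>\<close>] .
    have "\<rho> (Suc n) = \<rho> n + (t (Suc n) - t n) *\<^sub>R (v n $ i - v n $ j)"
      using \<rho>_flight[of n "t (Suc n) - t n"] by (simp add: \<rho>_def x_Suc)
    then have "pos (traj s) $ i - pos (traj s) $ j - ?l =
        (\<rho> (Suc n) - ?l) - (t (Suc n) - s) *\<^sub>R (v n $ i - v n $ j)"
      using \<rho>_flight[of n "s - t n"] traj_eq[OF n] by (simp add: algebra_simps)
    also have "norm \<dots> \<le> norm (\<rho> (Suc n) - ?l) + (t (Suc n) - s) * norm (v n $ i - v n $ j)"
      using n norm_triangle_ineq4[of "\<rho> (Suc n) - ?l" "(t (Suc n) - s) *\<^sub>R (v n $ i - v n $ j)"] by simp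
    also have "\<dots> \<le> W * (\<tau> - t (Suc n)) + (t (Suc n) - s) * W"
      using tail[of "Suc n"] bound[of n] n by (intro add_mono mult_left_mono) (auto simp: norm_minus_commute)
    finally show ?thesis by (simp add: algebra_simps)
  qed
  have "((\<lambda>s. W * (\<tau> - s)) \<longlongrightarrow> W * (\<tau> - \<tau>)) (at_left \<tau>)" by (intro tendsto_intros)
  then have "((\<lambda>s. W * (\<tau> - s)) \<longlongrightarrow> 0) (at_left \<tau>)" by simp
  moreover have "eventually (\<lambda>s. norm (pos (traj s) $ i - pos (traj s) $ j - ?l) \<le> W * (\<tau> - s)) (at_left \<tau>)"
    by (rule eventually_at_leftI[of 0]) (use near t_less[of 0] t0 in auto)
  ultimately have "((\<lambda>s. pos (traj s) $ i - pos (traj s) $ j - ?l) \<longlongrightarrow> 0) (at_left \<tau>)"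
    by (rule Lim_null_comparison[rotated])
  then have "((\<lambda>s. pos (traj s) $ i - pos (traj s) $ j) \<longlongrightarrow> ?l) (at_left \<tau>)" by (rule Lim_null[THEN iffD2])
  then show thesis using l by (auto intro: that simp: \<rho>_def[abs_def])
qed

end

section \<open>Collapse\<close>

context collapse_region
begin

text \<open>Particle \<open>c\<close> is the next one to be hit by particle \<open>0\<close>, and
  \<open>l\<close> the one hit last.\<close>

definition admissible :: "3 \<Rightarrow> 3 \<Rightarrow> real^'d::finite \<Rightarrow> real^'d \<Rightarrow> real^'d^3 \<Rightarrow> real^'d^3 \<Rightarrow> bool" where
  "admissible c l e f x v \<longleftrightarrow> region e f (x $ c - x $ 0) (v $ c - v $ 0) (x $ l - x $ 0) (v $ l - v $ 0)"

text \<open>This is \<open>q\<close>, the rate at which half the squared distance decreases; it is a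
  genuine speed only when that distance is \<open>1\<close>.\<close>

definition closing_speed :: "3 \<Rightarrow> real^'d::finite^3 \<Rightarrow> real^'d^3 \<Rightarrow> real" where
  "closing_speed c x v = - ((x $ c - x $ 0) \<bullet> (v $ c - v $ 0))"

text \<open>The transfer of \<open>region_step\<close> from relative coordinates to three particles.
  The last-hit particle may still touch particle \<open>0\<close> at the start, which is why
  separation at \<open>s = 0\<close> needs its own assumption.\<close>

lemma collision_step:
  fixes x v :: "real^'d::finite^3"
  assumes ix: "c \<noteq> 0" "l \<noteq> 0" "c \<noteq> l" and cen: "centre e f" and adm: "admissible c l e f x v"
  obtains \<tau> where "0 < \<tau>" "\<tau> \<le> 2 * \<epsilon> * closing_speed c x v"
    "\<And>x'. x' = x + \<tau> *\<^sub>R v \<Longrightarrow> norm (x' $ 0 - x' $ c) = 1 \<and> normal_velocity 0 c x' v < 0 \<and>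
       admissible l c f e x' (collide r 0 c x' v) \<and>
       closing_speed l x' (collide r 0 c x' v) \<le> \<alpha> * closing_speed c x v"
    "\<And>i j. i \<noteq> j \<Longrightarrow> {i, j} \<noteq> {0, c} \<Longrightarrow> 1 < norm ((x + \<tau> *\<^sub>R v) $ i - (x + \<tau> *\<^sub>R v) $ j)"
    "\<And>s i j. 0 \<le> s \<Longrightarrow> s < \<tau> \<Longrightarrow> 0 < s \<or> 1 < norm (x $ l - x $ 0) \<Longrightarrow> i \<noteq> j \<Longrightarrow>
       1 < norm ((x + s *\<^sub>R v) $ i - (x + s *\<^sub>R v) $ j)"
proof -
  define X V Y U where "X = x $ c - x $ 0" and "V = v $ c - v $ 0"
    and "Y = x $ l - x $ 0" and "U = v $ l - v $ 0"
  have reg: "region e f X V Y U" using adm by (simp add: admissible_def X_def V_def Y_def U_def)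
  obtain \<tau> where \<tau>: "0 < \<tau>" "\<tau> \<le> 2 * \<epsilon> * - (X \<bullet> V)" "norm (X + \<tau> *\<^sub>R V) = 1"
      "(X + \<tau> *\<^sub>R V) \<bullet> V < 0"
    and Xs: "\<And>s. 0 \<le> s \<Longrightarrow> s < \<tau> \<Longrightarrow> (norm (X + s *\<^sub>R V))\<^sup>2 > 1"
    and Ys: "\<And>s. 0 < s \<Longrightarrow> (norm (Y + s *\<^sub>R U))\<^sup>2 > 1"
    and near: "\<And>s. 0 \<le> s \<Longrightarrow> s \<le> \<tau> \<Longrightarrow> norm (X + s *\<^sub>R V - e) \<le> \<delta> \<and> norm (Y + s *\<^sub>R U - f) \<le> \<delta>"
    and step: "\<And>X' Y' V' U' c. X' = X + \<tau> *\<^sub>R V \<Longrightarrow> Y' = Y + \<tau> *\<^sub>R U \<Longrightarrow> c = (1 + r) / 2 * (X' \<bullet> V) \<Longrightarrow>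
       V' = V - (2 * c) *\<^sub>R X' \<Longrightarrow> U' = U - c *\<^sub>R X' \<Longrightarrow>
       region f e Y' U' X' V' \<and> - (Y' \<bullet> U') \<le> \<alpha> * - (X \<bullet> V)"
    using region_step[OF cen reg] by metis
  have Xrel: "(x + s *\<^sub>R v) $ c - (x + s *\<^sub>R v) $ 0 = X + s *\<^sub>R V" for s
    by (simp add: X_def V_def algebra_simps)
  have Yrel: "(x + s *\<^sub>R v) $ l - (x + s *\<^sub>R v) $ 0 = Y + s *\<^sub>R U" for s
    by (simp add: Y_def U_def algebra_simps)
  have XYrel: "(x + s *\<^sub>R v) $ c - (x + s *\<^sub>R v) $ l = (X + s *\<^sub>R V) - (Y + s *\<^sub>R U)" for s
    by (simp add: X_def V_def Y_def U_def algebra_simps)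
  have gt1: "1 < norm a" if "1 < (norm a)\<^sup>2" for a :: "real^'d"
    using that power2_less_imp_less[of 1 "norm a"] by simp
  have Y0: "1 < norm (Y + s *\<^sub>R U)" if "0 \<le> s" "0 < s \<or> 1 < norm (x $ l - x $ 0)" for s
    using that gt1[OF Ys[of s]] by (cases "s = 0") (auto simp: Y_def)
  have XY: "1 < norm ((X + s *\<^sub>R V) - (Y + s *\<^sub>R U))" if "0 \<le> s" "s \<le> \<tau>" for s
  proof (rule near_centre_far_apart[OF cen])
    show "1 \<le> (norm (X + s *\<^sub>R V))\<^sup>2" using Xs[of s] that \<tau> by (cases "s = \<tau>") auto
    show "1 \<le> (norm (Y + s *\<^sub>R U))\<^sup>2"
      using Ys[of s] that region_D(6)[OF reg] by (cases "s = 0") auto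
  qed (use near[OF that] in auto)
  have "UNIV = {0, c, l}"
  proof -
    have "card {0, c, l} = 3" using ix by auto
    then show ?thesis by (intro card_seteq[symmetric]) auto
  qed
  then have cases3: "i = 0 \<or> i = c \<or> i = l" for i by blast
  have far: "1 < norm (z $ i - z $ j)"
    if "i \<noteq> j" "{i, j} \<noteq> {0, c} \<or> 1 < norm (z $ c - z $ 0)" "1 < norm (z $ l - z $ 0)"
      "1 < norm (z $ c - z $ l)" for i j and z :: "real^'d^3"
    using that cases3[of i] cases3[of j] by (auto simp: norm_minus_commute insert_commute)
  show thesis
  proof (rule that[of \<tau>])
    show "0 < \<tau>" by (rule \<tau>)
    show "\<tau> \<le> 2 * \<epsilon> * closing_speed c x v"
      using \<tau> by (simp add: closing_speed_def X_def V_def)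
    show "1 < norm ((x + \<tau> *\<^sub>R v) $ i - (x + \<tau> *\<^sub>R v) $ j)" if "i \<noteq> j" "{i, j} \<noteq> {0, c}" for i j
    proof (rule far)
      show "1 < norm ((x + \<tau> *\<^sub>R v) $ l - (x + \<tau> *\<^sub>R v) $ 0)"
        using Y0[of \<tau>] \<tau> unfolding Yrel by simp
      show "1 < norm ((x + \<tau> *\<^sub>R v) $ c - (x + \<tau> *\<^sub>R v) $ l)"
        using XY[of \<tau>] \<tau> unfolding XYrel by simp
    qed (use that in auto)
    show "1 < norm ((x + s *\<^sub>R v) $ i - (x + s *\<^sub>R v) $ j)"
      if "0 \<le> s" "s < \<tau>" "0 < s \<or> 1 < norm (x $ l - x $ 0)" "i \<noteq> j" for s i j
    proof (rule far)
      show "{i, j} \<noteq> {0, c} \<or> 1 < norm ((x + s *\<^sub>R v) $ c - (x + s *\<^sub>R v) $ 0)"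
        using gt1[OF Xs[of s]] that unfolding Xrel by blast
      show "1 < norm ((x + s *\<^sub>R v) $ l - (x + s *\<^sub>R v) $ 0)"
        using Y0 that unfolding Yrel by blast
      show "1 < norm ((x + s *\<^sub>R v) $ c - (x + s *\<^sub>R v) $ l)"
        using XY[of s] that unfolding XYrel by simp
    qed (rule that)
    fix x' assume x': "x' = x + \<tau> *\<^sub>R v"
    define X' Y' where "X' = X + \<tau> *\<^sub>R V" and "Y' = Y + \<tau> *\<^sub>R U"
    define k where "k = (1 + r) / 2 * (X' \<bullet> V)"
    have X': "x' $ c - x' $ 0 = X'" and Y': "x' $ l - x' $ 0 = Y'"
      unfolding x' Xrel Yrel X'_def Y'_def by simp_all
    have nX': "norm X' = 1" using \<tau> by (simp add: X'_def)
    have "x' $ 0 - x' $ c = - X'" using X' by (metis minus_diff_eq)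
    then have dir: "contact_dir 0 c x' = - X'" and n1: "norm (x' $ 0 - x' $ c) = 1"
      using nX' by (simp_all add: contact_dir_def)
    have nv: "normal_velocity 0 c x' v = X' \<bullet> V"
      by (simp add: normal_velocity_def dir V_def inner_diff_left inner_diff_right inner_commute)
    \<comment> \<open>The impulse on \<open>0\<close> is opposite to that on \<open>c\<close>, so
      the velocity of \<open>c\<close> relative to \<open>0\<close> changes twice; \<open>l\<close>
      keeps its velocity, but its relative velocity changes once.\<close>
    define v' where "v' = collide r 0 c x' v"
    have "v' $ 0 = v $ 0 + k *\<^sub>R X'" "v' $ c = v $ c - k *\<^sub>R X'" "v' $ l = v $ l"
      using ix by (auto simp: v'_def collide_def dir nv k_def)
    moreover have "(2 * k) *\<^sub>R X' = k *\<^sub>R X' + k *\<^sub>R X'"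
      by (simp flip: scaleR_add_left)
    ultimately have "v' $ c - v' $ 0 = V - (2 * k) *\<^sub>R X'" "v' $ l - v' $ 0 = U - k *\<^sub>R X'"
      by (simp_all add: V_def U_def)
    then have "region f e Y' (v' $ l - v' $ 0) X' (v' $ c - v' $ 0) \<and>
        - (Y' \<bullet> (v' $ l - v' $ 0)) \<le> \<alpha> * - (X \<bullet> V)"
      by (intro step[of X' Y' k]) (simp_all add: X'_def Y'_def k_def)
    then show "norm (x' $ 0 - x' $ c) = 1 \<and> normal_velocity 0 c x' v < 0 \<and>
       admissible l c f e x' (collide r 0 c x' v) \<and>
       closing_speed l x' (collide r 0 c x' v) \<le> \<alpha> * closing_speed c x v"
      using n1 nv \<tau> unfolding v'_def[symmetric] admissible_def closing_speed_def X' Y'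
      by (simp add: X_def[symmetric] V_def[symmetric] X'_def[symmetric])
  qed
qed

text \<open>Iterating \<open>collision_step\<close> gives closing speeds, hence flight times,
  bounded by a geometric sequence, so the collision times converge. The bounds of the region on
  positions pass to the limit.\<close>

lemma collapse_from_region:
  fixes Z0 :: "'d::finite state" and e f :: "real^'d"
  assumes cen: "centre e f" and adm0: "admissible 1 2 e f (pos Z0) (vel Z0)"
    and sep0: "1 < norm (pos Z0 $ 2 - pos Z0 $ 0)"
  shows "\<exists>\<tau> Z y1 y2. nearly_linear_collapse r \<tau> Z0 Z \<and>
    ((\<lambda>s. pos (Z s) $ 1 - pos (Z s) $ 0) \<longlongrightarrow> y1) (at_left \<tau>) \<and>
    ((\<lambda>s. pos (Z s) $ 2 - pos (Z s) $ 0) \<longlongrightarrow> y2) (at_left \<tau>) \<and>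
    norm (y1 - e) \<le> \<delta> \<and> norm (y2 - f) \<le> \<delta>"
proof -
  define c l :: "nat \<Rightarrow> 3" where "c n = (if even n then 1 else 2)" and "l n = (if even n then 2 else 1)" for n
  define E where "E i = (if i = (1::3) then e else f)" for i
  have cl: "c n \<noteq> 0" "l n \<noteq> 0" "c n \<noteq> l n" "c (Suc n) = l n" "l (Suc n) = c n" for n
    by (auto simp: c_def l_def)
  have cenE: "centre (E (c n)) (E (l n))" for n
    using cen centre_sym[OF cen] by (auto simp: E_def c_def l_def)
  \<comment> \<open>The clause for \<open>n = 0\<close> ties the chosen sequence to time
    \<open>0\<close> and the state \<open>Z0\<close>; it also lets \<open>sep0\<close> exclude an
    initial contact.\<close>
  define P where "P n s \<longleftrightarrow> (case s of (t, x, v) \<Rightarrow>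
      admissible (c n) (l n) (E (c n)) (E (l n)) x v \<and> (n = 0 \<longrightarrow> t = 0 \<and> (x, v) = Z0))"
    for n and s :: "real \<times> (real^'d^3) \<times> (real^'d^3)"
  define Q where "Q n s s' \<longleftrightarrow> (case s of (t, x, v) \<Rightarrow> case s' of (t', x', v') \<Rightarrow>
      t < t' \<and> t' - t \<le> 2 * \<epsilon> * closing_speed (c n) x v \<and>
      x' = x + (t' - t) *\<^sub>R v \<and> v' = collide r 0 (c n) x' v \<and>
      norm (x' $ 0 - x' $ c n) = 1 \<and> normal_velocity 0 (c n) x' v < 0 \<and>
      closing_speed (c (Suc n)) x' v' \<le> \<alpha> * closing_speed (c n) x v \<and>
      (\<forall>i j. i \<noteq> j \<longrightarrow> {i, j} \<noteq> {0, c n} \<longrightarrow> 1 < norm (x' $ i - x' $ j)) \<and>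
      (\<forall>s i j. 0 \<le> s \<longrightarrow> s < t' - t \<longrightarrow> n = 0 \<or> 0 < s \<longrightarrow> i \<noteq> j \<longrightarrow>
        1 < norm ((x + s *\<^sub>R v) $ i - (x + s *\<^sub>R v) $ j)))"
    for n and s s' :: "real \<times> (real^'d^3) \<times> (real^'d^3)"
  have "\<exists>F. \<forall>n. P n (F n) \<and> Q n (F n) (F (Suc n))"
  proof (rule dependent_nat_choice)
    show "\<exists>s. P 0 s"
      by (rule exI[of _ "(0, Z0)"]) (use adm0 in \<open>auto simp: P_def E_def c_def l_def split: prod.splits\<close>)
    fix s n assume Ps: "P n s"
    obtain t x v where s: "s = (t, x, v)" by (cases s) auto
    have adm: "admissible (c n) (l n) (E (c n)) (E (l n)) x v" using Ps by (simp add: P_def s)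
    have sep: "n = 0 \<Longrightarrow> 1 < norm (x $ l n - x $ 0)"
      using Ps sep0 by (auto simp: P_def s l_def)
    obtain h where h: "0 < h" "h \<le> 2 * \<epsilon> * closing_speed (c n) x v"
      and h1: "\<And>x'. x' = x + h *\<^sub>R v \<Longrightarrow> norm (x' $ 0 - x' $ c n) = 1 \<and> normal_velocity 0 (c n) x' v < 0 \<and>
       admissible (l n) (c n) (E (l n)) (E (c n)) x' (collide r 0 (c n) x' v) \<and>
       closing_speed (l n) x' (collide r 0 (c n) x' v) \<le> \<alpha> * closing_speed (c n) x v"
      and h2: "\<And>i j. i \<noteq> j \<Longrightarrow> {i, j} \<noteq> {0, c n} \<Longrightarrow> 1 < norm ((x + h *\<^sub>R v) $ i - (x + h *\<^sub>R v) $ j)"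
      and h3: "\<And>s i j. 0 \<le> s \<Longrightarrow> s < h \<Longrightarrow> 0 < s \<or> 1 < norm (x $ l n - x $ 0) \<Longrightarrow> i \<noteq> j \<Longrightarrow>
         1 < norm ((x + s *\<^sub>R v) $ i - (x + s *\<^sub>R v) $ j)"
      using collision_step[OF cl(1-3) cenE adm] by metis
    define x' where "x' = x + h *\<^sub>R v"
    have "P (Suc n) (t + h, x', collide r 0 (c n) x' v)"
      using h1[OF x'_def] by (simp add: P_def cl)
    moreover have "Q n s (t + h, x', collide r 0 (c n) x' v)"
      using h h1[OF x'_def] h2 h3 sep unfolding Q_def s cl by (auto simp: x'_def)
    ultimately show "\<exists>s'. P (Suc n) s' \<and> Q n s s'" by blast
  qed
  then obtain F where F: "\<And>n. P n (F n)" "\<And>n. Q n (F n) (F (Suc n))" by blast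
  define t x v where "t n = fst (F n)" and "x n = fst (snd (F n))" and "v n = snd (snd (F n))" for n
  have Feq: "F n = (t n, x n, v n)" for n by (simp add: t_def x_def v_def)
  have adm: "admissible (c n) (l n) (E (c n)) (E (l n)) (x n) (v n)" for n
    using F(1)[of n] by (simp add: P_def Feq)
  have init: "t 0 = 0" "(x 0, v 0) = Z0" using F(1)[of 0] by (auto simp: P_def Feq)
  have step: "t n < t (Suc n)" "t (Suc n) - t n \<le> 2 * \<epsilon> * closing_speed (c n) (x n) (v n)"
      "x (Suc n) = x n + (t (Suc n) - t n) *\<^sub>R v n" "v (Suc n) = collide r 0 (c n) (x (Suc n)) (v n)"
      "norm (x (Suc n) $ 0 - x (Suc n) $ c n) = 1" "normal_velocity 0 (c n) (x (Suc n)) (v n) < 0"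
      "closing_speed (c (Suc n)) (x (Suc n)) (v (Suc n)) \<le> \<alpha> * closing_speed (c n) (x n) (v n)"
    and others: "\<forall>i j. i \<noteq> j \<longrightarrow> {i, j} \<noteq> {0, c n} \<longrightarrow> 1 < norm (x (Suc n) $ i - x (Suc n) $ j)"
    and flight: "\<forall>s i j. 0 \<le> s \<longrightarrow> s < t (Suc n) - t n \<longrightarrow> n = 0 \<or> 0 < s \<longrightarrow> i \<noteq> j \<longrightarrow>
        1 < norm ((x n + s *\<^sub>R v n) $ i - (x n + s *\<^sub>R v n) $ j)" for n
    by (insert F(2)[of n], unfold Q_def Feq prod.case, (elim conjE, assumption)+)
  have \<alpha>: "0 \<le> \<alpha>" "\<alpha> < 1" using \<kappa> by linarith+
  have speed: "closing_speed (c n) (x n) (v n) \<le> closing_speed (c 0) (x 0) (v 0) * \<alpha> ^ n" for n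
  proof (induction n)
    case (Suc n)
    then have "\<alpha> * closing_speed (c n) (x n) (v n) \<le> \<alpha> * (closing_speed (c 0) (x 0) (v 0) * \<alpha> ^ n)"
      using \<alpha> by (intro mult_left_mono)
    then show ?case using step(7)[of n] by (simp add: mult_ac)
  qed simp
  have "summable (\<lambda>n. t (Suc n) - t n)"
  proof (rule summable_comparison_test')
    show "summable (\<lambda>n. 2 * \<epsilon> * (closing_speed (c 0) (x 0) (v 0) * \<alpha> ^ n))"
      using \<alpha> by (intro summable_mult summable_geometric) auto
    show "norm (t (Suc n) - t n) \<le> 2 * \<epsilon> * (closing_speed (c 0) (x 0) (v 0) * \<alpha> ^ n)" for n
    proof -
      have "2 * \<epsilon> * closing_speed (c n) (x n) (v n) \<le> 2 * \<epsilon> * (closing_speed (c 0) (x 0) (v 0) * \<alpha> ^ n)"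
        using \<epsilon> speed[of n] by (intro mult_left_mono) auto
      then show ?thesis using step(1,2)[of n] by simp
    qed
  qed
  then have "convergent t"
    by (simp add: summable_iff_convergent sum_lessThan_telescope init)
  then obtain \<tau> where \<tau>: "t \<longlonglongrightarrow> \<tau>" by (auto simp: convergent_def)
  interpret cs: collision_sequence r \<tau> t x v c
  proof
    show "strict_mono t" using step(1) by (intro strict_monoI_Suc)
    show "1 < norm ((x n + (s - t n) *\<^sub>R v n) $ i - (x n + (s - t n) *\<^sub>R v n) $ j)"
      if "t n \<le> s" "s < t (Suc n)" "n = 0 \<or> t n < s" "i \<noteq> j" for n s i j
    proof -
      have "0 \<le> s - t n" "s - t n < t (Suc n) - t n" "n = 0 \<or> 0 < s - t n" using that by auto
      then show ?thesis using flight[of n] \<open>i \<noteq> j\<close> by blast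
    qed
  qed (use init \<tau> step others cl in auto)
  have admD: "region (E (c n)) (E (l n)) (x n $ c n - x n $ 0) (v n $ c n - v n $ 0)
      (x n $ l n - x n $ 0) (v n $ l n - v n $ 0)" for n
    using adm[of n] by (simp add: admissible_def)
  have vel: "norm (v n $ 1 - v n $ 0) \<le> W" "norm (v n $ 2 - v n $ 0) \<le> W" for n
    using region_D(1,2)[OF admD[of n]] by (auto simp: c_def l_def split: if_splits)
  have near: "norm (x n $ 1 - x n $ 0 - e) \<le> \<delta>" "norm (x n $ 2 - x n $ 0 - f) \<le> \<delta>" for n
    using region_D(3,4)[OF admD[of n]] by (auto simp: c_def l_def E_def split: if_splits)
  obtain y1 where y1: "((\<lambda>s. pos (cs.traj s) $ 1 - pos (cs.traj s) $ 0) \<longlongrightarrow> y1) (at_left \<tau>)"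
    "(\<lambda>n. x n $ 1 - x n $ 0) \<longlonglongrightarrow> y1"
    using cs.relative_position_limit[OF vel(1)] .
  obtain y2 where y2: "((\<lambda>s. pos (cs.traj s) $ 2 - pos (cs.traj s) $ 0) \<longlongrightarrow> y2) (at_left \<tau>)"
    "(\<lambda>n. x n $ 2 - x n $ 0) \<longlonglongrightarrow> y2"
    using cs.relative_position_limit[OF vel(2)] .
  have "norm (y1 - e) \<le> \<delta>"
    by (rule Lim_norm_ubound[OF _ tendsto_diff[OF y1(2) tendsto_const]]) (use near in auto)
  moreover have "norm (y2 - f) \<le> \<delta>"
    by (rule Lim_norm_ubound[OF _ tendsto_diff[OF y2(2) tendsto_const]]) (use near in auto)
  moreover have "nearly_linear_collapse r \<tau> Z0 cs.traj"
    using cs.nearly_linear_collapse by (simp add: init c_def)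
  ultimately show ?thesis using y1(1) y2(1) by blast
qed

end

section \<open>An open set of initial states\<close>

context collapse_region
begin

text \<open>Making the inequalities of the region strict gives an open set \<open>G\<close>, whose
  trace on the phase space is its own relative interior. The extra hypotheses ensure that the
  explicit state \<open>Z1\<close> lies in it.\<close>

lemma collapse_set:
  fixes e f :: "real^'d::finite"
  assumes cen: "centre e f" and W': "1 + 2 * C < W" and \<epsilon>': "\<epsilon> \<le> 1" and \<delta>': "S * \<epsilon> / 4 + 2 * D < \<delta>"
  shows "\<exists>ZK :: 'd state set. ZK \<subseteq> phase_space \<and> top_of_set phase_space interior_of ZK \<noteq> {} \<and>
    (\<forall>Z0\<in>ZK. \<exists>\<tau> Z y1 y2. nearly_linear_collapse r \<tau> Z0 Z \<and>
      ((\<lambda>s. pos (Z s) $ 1 - pos (Z s) $ 0) \<longlongrightarrow> y1) (at_left \<tau>) \<and>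
      ((\<lambda>s. pos (Z s) $ 2 - pos (Z s) $ 0) \<longlongrightarrow> y2) (at_left \<tau>) \<and>
      norm (y1 - e) \<le> \<delta> \<and> norm (y2 - f) \<le> \<delta>)"
proof -
  define X Y V U :: "'d state \<Rightarrow> real^'d" where "X Z = pos Z $ 1 - pos Z $ 0"
    and "Y Z = pos Z $ 2 - pos Z $ 0" and "V Z = vel Z $ 1 - vel Z $ 0"
    and "U Z = vel Z $ 2 - vel Z $ 0" for Z
  define G where "G = {Z. 0 < - (X Z \<bullet> V Z) \<and> 0 < Y Z \<bullet> U Z \<and> Y Z \<bullet> U Z < S * - (X Z \<bullet> V Z) \<and>
     1 < (norm (X Z))\<^sup>2 \<and> 1 < (norm (Y Z))\<^sup>2 \<and>
     ((norm (Y Z))\<^sup>2 - 1) / 2 + S * (((norm (X Z))\<^sup>2 - 1) / 2) < S * \<epsilon> * (X Z \<bullet> V Z)\<^sup>2 \<and>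
     norm (V Z) + C * - (X Z \<bullet> V Z) < W \<and> norm (U Z) + C * - (X Z \<bullet> V Z) < W \<and>
     norm (X Z - e) + D * - (X Z \<bullet> V Z) < \<delta> \<and> norm (Y Z - f) + D * - (X Z \<bullet> V Z) < \<delta>}"
  have "open G"
    unfolding G_def X_def Y_def U_def V_def
    by (intro open_Collect_conj open_Collect_less continuous_intros) auto
  have adm: "admissible 1 2 e f (pos Z) (vel Z)" and sep: "1 < norm (pos Z $ 2 - pos Z $ 0)"
    if "Z \<in> G" for Z
    using that power2_less_imp_less[of 1 "norm (Y Z)"]
    by (auto simp: G_def admissible_def region_def X_def Y_def U_def V_def)
  \<comment> \<open>Particle \<open>0\<close> rests at the origin, the others lie slightly beyond
    contact along \<open>e\<close> and \<open>f\<close>. Particle \<open>1\<close> approaches with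
    speed \<open>1\<close>, particle \<open>2\<close> recedes with speed \<open>S / 2\<close>, so
    \<open>p / q = S / 2\<close>. With offset \<open>h = S * \<epsilon> / 4\<close> the weighted
    gaps are at most \<open>3 * h\<close>, below the allowed
    \<open>4 * h * (1 + h)^2\<close>.\<close>
  define Z1 :: "'d state" where "Z1 = ((\<chi> i. (1 + S * \<epsilon> / 4) *\<^sub>R (if i = 0 then 0 else if i = 1 then e else f)),
    (\<chi> i. if i = 0 then 0 else if i = 1 then - e else (S / 2) *\<^sub>R f))"
  define h where "h = S * \<epsilon> / 4"
  have h: "0 < h" "h \<le> 1"
  proof -
    have "S * \<epsilon> \<le> 1 * 1" using S \<epsilon> \<epsilon>' by (intro mult_mono) auto
    then show "0 < h" "h \<le> 1" using S \<epsilon> by (auto simp: h_def)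
  qed
  have Z1: "X Z1 = (1 + h) *\<^sub>R e" "Y Z1 = (1 + h) *\<^sub>R f" "V Z1 = - e" "U Z1 = (S / 2) *\<^sub>R f"
    by (auto simp: Z1_def X_def Y_def U_def V_def h_def)
  have ef: "norm e = 1" "norm f = 1" "e \<bullet> e = 1" "f \<bullet> f = 1"
    using cen by (auto simp: centre_def norm_eq_1)
  have q: "- (X Z1 \<bullet> V Z1) = 1 + h" using ef by (simp add: Z1)
  then have q2: "(X Z1 \<bullet> V Z1)\<^sup>2 = (1 + h)\<^sup>2" by (metis power2_minus)
  have p: "Y Z1 \<bullet> U Z1 = (1 + h) * (S / 2)" using ef by (simp add: Z1)
  have nXY: "(norm (X Z1))\<^sup>2 = (1 + h)\<^sup>2" "(norm (Y Z1))\<^sup>2 = (1 + h)\<^sup>2" using ef h by (auto simp: Z1)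
  have nVU: "norm (V Z1) = 1" "norm (U Z1) = S / 2" using ef S by (auto simp: Z1)
  have nd: "norm (X Z1 - e) = h" "norm (Y Z1 - f) = h" using ef h by (auto simp: Z1 scaleR_add_left)
  have "(1 + h)\<^sup>2 > 1" using h by (simp add: power2_eq_square algebra_simps add_pos_pos)
  have gap: "((1 + h)\<^sup>2 - 1) / 2 + S * (((1 + h)\<^sup>2 - 1) / 2) < S * \<epsilon> * (1 + h)\<^sup>2"
  proof -
    have "((1 + h)\<^sup>2 - 1) / 2 = h + h * h / 2" by (simp add: power2_eq_square algebra_simps add_divide_distrib)
    also have "\<dots> \<le> h + 1 * h / 2" using h by (intro add_left_mono divide_right_mono mult_right_mono) auto
    finally have g: "((1 + h)\<^sup>2 - 1) / 2 \<le> 3 / 2 * h" by simp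
    have "((1 + h)\<^sup>2 - 1) / 2 + S * (((1 + h)\<^sup>2 - 1) / 2) \<le> 3 / 2 * h + 1 * (3 / 2 * h)"
      using S g \<open>(1 + h)\<^sup>2 > 1\<close> by (intro add_mono mult_mono) auto
    also have "\<dots> < 4 * h * 1" using h by simp
    also have "\<dots> \<le> 4 * h * (1 + h)\<^sup>2" using h \<open>(1 + h)\<^sup>2 > 1\<close> by (intro mult_left_mono) auto
    finally show ?thesis by (simp add: h_def)
  qed
  have "C * (1 + h) \<le> C * 2" "D * (1 + h) \<le> D * 2" "0 < (1 + h) * (S / 2)"
    "(1 + h) * (S / 2) < S * (1 + h)"
    using C D S h by auto
  then have Z1G: "Z1 \<in> G"
    unfolding G_def mem_Collect_eq q q2 p nXY nVU nd
    using h S gap \<open>(1 + h)\<^sup>2 > 1\<close> W' \<delta>' unfolding h_def[symmetric]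
    by (intro conjI; linarith)
  have "Z1 \<in> phase_space"
  proof -
    have "1 < norm (pos Z1 $ 1 - pos Z1 $ 2)"
    proof -
      have "1 < norm (X Z1 - Y Z1)"
        using region_D[OF adm[OF Z1G, unfolded admissible_def]]
        by (intro near_centre_far_apart[OF cen]) (simp_all add: X_def Y_def)
      then show ?thesis by (simp add: X_def Y_def)
    qed
    moreover have "1 < norm (X Z1)" "1 < norm (Y Z1)" using ef h by (simp_all add: Z1)
    ultimately have far: "1 < norm (pos Z1 $ 1 - pos Z1 $ 2)" "1 < norm (pos Z1 $ 1 - pos Z1 $ 0)"
      "1 < norm (pos Z1 $ 2 - pos Z1 $ 0)" by (simp_all add: X_def Y_def)
    \<comment> \<open>The enumeration in \<open>forall_3\<close> names the elements
      \<open>1\<close>, \<open>2\<close>, \<open>3\<close>, and \<open>3\<close> is \<open>0\<close>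
      in this type.\<close>
    have three: "(3::3) = 0" by simp
    show ?thesis
      unfolding phase_space_def mem_Collect_eq forall_3 three
      using far by (simp add: norm_minus_commute)
  qed
  have ZK: "top_of_set phase_space interior_of (phase_space \<inter> G) = phase_space \<inter> G"
    using \<open>open G\<close> by (intro interior_of_openin openin_open_Int)
  show ?thesis
  proof (intro exI[of _ "phase_space \<inter> G"] conjI ballI)
    show "top_of_set phase_space interior_of (phase_space \<inter> G) \<noteq> {}"
      unfolding ZK using Z1G \<open>Z1 \<in> phase_space\<close> by blast
  qed (use collapse_from_region[OF cen adm sep] in auto)
qed

end

section \<open>Angles between vectors\<close>

text \<open>Cauchy-Schwarz puts the quotient into the domain of \<open>arccos\<close>; for a zero
  vector the quotient is \<open>0\<close> by the convention on division.\<close>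

lemma cos_vec_angle: "cos (vec_angle u v) = u \<bullet> v / (norm u * norm v)"
proof -
  have "\<bar>u \<bullet> v / (norm u * norm v)\<bar> \<le> 1"
    using Cauchy_Schwarz_ineq2[of u v] by (cases "norm u * norm v = 0") (auto simp: divide_le_eq_1)
  then show ?thesis by (simp add: vec_angle_def cos_arccos_abs)
qed

lemma cos_vec_angle_near:
  fixes e f :: "'a::real_inner"
  assumes "norm e = 1" "norm f = 1" "\<delta> > 0"
  obtains d where "d > 0"
    "\<And>u v. norm (u - e) \<le> d \<Longrightarrow> norm (v - f) \<le> d \<Longrightarrow> \<bar>cos (vec_angle u v) - e \<bullet> f\<bar> \<le> \<delta>"
proof -
  have "continuous (at (e, f)) (\<lambda>p. fst p \<bullet> snd p / (norm (fst p) * norm (snd p)))"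
    using assms by (intro continuous_intros) auto
  then obtain d where d: "d > 0" "\<And>p. dist p (e, f) < d \<Longrightarrow>
      dist (fst p \<bullet> snd p / (norm (fst p) * norm (snd p))) (e \<bullet> f) < \<delta>"
    using assms unfolding continuous_at_eps_delta by fastforce
  show thesis
  \<comment> \<open>The distance of pairs is at most the sum of the two deviations, hence at most
    \<open>2 * d / 3 < d\<close>.\<close>
  proof (rule that[of "d / 3"])
    show "\<bar>cos (vec_angle u v) - e \<bullet> f\<bar> \<le> \<delta>" if "norm (u - e) \<le> d / 3" "norm (v - f) \<le> d / 3" for u v
    proof -
      have "dist (u, v) (e, f) \<le> norm (u - e) + norm (v - f)"
        using norm_Pair_le[of "u - e" "v - f"] by (simp add: dist_norm)
      then show ?thesis
        using d(2)[of "(u, v)"] that \<open>d > 0\<close> by (simp add: cos_vec_angle dist_real_def)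
    qed
  qed (use d in auto)
qed

lemma unit_vectors_with_angle:
  assumes "CARD('d::finite) \<ge> 2"
  obtains e f :: "real^'d" where "norm e = 1" "norm f = 1" "e \<bullet> f = cos \<theta>"
proof -
  obtain i j :: 'd where ij: "i \<noteq> j"
    using assms by (metis (full_types) One_nat_def Suc_1 UNIV_I card_le_Suc0_iff_eq finite not_less_eq_eq)
  define e f :: "real^'d" where "e = axis i 1" and "f = cos \<theta> *\<^sub>R axis i 1 + sin \<theta> *\<^sub>R axis j 1"
  have "f \<bullet> f = (cos \<theta>)\<^sup>2 + (sin \<theta>)\<^sup>2"
    using ij by (simp add: f_def inner_add_left inner_add_right inner_axis_axis power2_eq_square)
  then show thesis
    using ij by (intro that[of e f])
      (auto simp: norm_eq_1 e_def f_def inner_add_right inner_axis_axis)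
qed

section \<open>Choice of the constants\<close>

lemma exists_small_pos:
  assumes "eventually P (at_right (0::real))"
  obtains x where "x > 0" "P x"
proof -
  have "eventually (\<lambda>x. x > 0 \<and> P x) (at_right 0)"
    using eventually_at_right_less assms by (rule eventually_conj)
  then show thesis using that eventually_happens' trivial_limit_at_right_real by blast
qed

text \<open>For \<open>\<kappa> = 0\<close> the balanced choice is \<open>S = y^2\<close> and
  \<open>y = a - S\<close>, so \<open>y\<close> is the positive root of \<open>y^2 + y = a\<close>.
  The remaining condition \<open>r < S * y\<close> reads \<open>root 3 r < y\<close>, which is the
  hypothesis because \<open>u + u^2\<close> increases for positive \<open>u\<close>. All conditions
  are strict, so a small \<open>\<kappa>\<close> keeps them.\<close>

lemma exists_contracting_slope:
  fixes a r :: real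
  assumes "0 < r" "root 3 r + (root 3 r)\<^sup>2 < a" "a < 1"
  obtains \<kappa> y where "0 < \<kappa>" "0 < y" "3 * \<kappa> < y\<^sup>2" "y\<^sup>2 + y = a" "r < (y\<^sup>2 - 3 * \<kappa>) * (y + \<kappa>)" "a + \<kappa> < 1"
proof -
  define u where "u = root 3 r"
  have u: "u > 0" "u ^ 3 = r" "u + u\<^sup>2 < a" using assms by (auto simp: u_def)
  define y where "y = (sqrt (1 + 4 * a) - 1) / 2"
  have a: "a > 0" using u by (smt (verit) zero_le_power2)
  then have y: "y > 0" by (simp add: y_def)
  have "2 * y + 1 = sqrt (1 + 4 * a)" by (simp add: y_def field_simps)
  then have "(2 * y + 1)\<^sup>2 = 1 + 4 * a" using a by simp
  then have ya: "y\<^sup>2 + y = a" by (simp add: power2_eq_square algebra_simps)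
  have "u < y"
  proof (rule ccontr)
    assume "\<not> u < y"
    then have "y\<^sup>2 \<le> u\<^sup>2" using y by (intro power_mono) auto
    then show False using ya u \<open>\<not> u < y\<close> by linarith
  qed
  then have "u ^ 3 < y ^ 3" using u by (intro power_strict_mono) auto
  then have yr: "r < y\<^sup>2 * y" using u by (simp add: power3_eq_cube power2_eq_square)
  have "((\<lambda>k. (y\<^sup>2 - 3 * k) * (y + k)) \<longlongrightarrow> (y\<^sup>2 - 3 * 0) * (y + 0)) (at_right 0)"
    by (intro tendsto_intros)
  then have "eventually (\<lambda>k. r < (y\<^sup>2 - 3 * k) * (y + k)) (at_right 0)"
    using yr by (intro order_tendstoD) auto
  moreover have "eventually (\<lambda>k. k < min (y\<^sup>2 / 3) (1 - a)) (at_right 0)"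
    using y assms by (intro eventually_at_rightI[of 0 "min (y\<^sup>2 / 3) (1 - a)"]) auto
  ultimately have "eventually (\<lambda>k. r < (y\<^sup>2 - 3 * k) * (y + k) \<and> k < min (y\<^sup>2 / 3) (1 - a)) (at_right 0)"
    by (rule eventually_conj)
  then obtain \<kappa> where "\<kappa> > 0" "r < (y\<^sup>2 - 3 * \<kappa>) * (y + \<kappa>) \<and> \<kappa> < min (y\<^sup>2 / 3) (1 - a)"
    by (rule exists_small_pos)
  then show thesis using that[of \<kappa> y] y ya by auto
qed

theorem theorem1:
  fixes r \<theta>\<^sub>0 \<delta> :: real
  assumes "CARD('d::finite) \<ge> 2"
    and "0 < r" and "r < r_stabi"
    and "pi / 2 < \<theta>\<^sub>0" and "\<theta>\<^sub>0 \<le> pi"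
    and "- cos \<theta>\<^sub>0 > 2 * root 3 r * (1 + root 3 r) / (1 + r)"
    and "\<delta> > 0"
  shows "\<exists>ZK :: 'd state set.
           ZK \<subseteq> phase_space \<and>
           top_of_set phase_space interior_of ZK \<noteq> {} \<and>
           (\<forall>Z0\<in>ZK. \<exists>\<tau> Z \<theta>.
              nearly_linear_collapse r \<tau> Z0 Z \<and>
              has_final_angle \<tau> Z \<theta> \<and>
              \<bar>(- cos \<theta>) - (- cos \<theta>\<^sub>0)\<bar> \<le> \<delta>)"
proof -
  \<comment> \<open>This bound gives \<open>r_stabi < 1\<close>, whence
    \<open>r < 1\<close>.\<close>
  have "2 < sqrt 5" by (rule real_less_rsqrt) simp
  then have r: "0 < r" "r < 1" using assms by (auto simp: r_stabi_def)
  define a where "a = (1 + r) / 2 * (- cos \<theta>\<^sub>0)"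
  have "(1 + r) / 2 * (- cos \<theta>\<^sub>0) \<le> (1 + r) / 2 * 1"
    using r cos_ge_minus_one[of \<theta>\<^sub>0] by (intro mult_left_mono) auto
  then have a1: "a < 1" using r by (simp add: a_def)
  have "root 3 r + (root 3 r)\<^sup>2 < a"
    using assms(6) r by (simp add: a_def field_simps power2_eq_square)
  then obtain \<kappa> y where \<kappa>: "0 < \<kappa>" "0 < y" "3 * \<kappa> < y\<^sup>2" "y\<^sup>2 + y = a"
    "r < (y\<^sup>2 - 3 * \<kappa>) * (y + \<kappa>)" "a + \<kappa> < 1"
    using exists_contracting_slope[OF r(1) _ a1] by metis
  obtain e f :: "real^'d" where ef: "norm e = 1" "norm f = 1" "e \<bullet> f = cos \<theta>\<^sub>0"
    using unit_vectors_with_angle[OF assms(1)] .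
  obtain d where d: "d > 0"
    "\<And>u v. norm (u - e) \<le> d \<Longrightarrow> norm (v - f) \<le> d \<Longrightarrow> \<bar>cos (vec_angle u v) - e \<bullet> f\<bar> \<le> \<delta>"
    using cos_vec_angle_near[OF ef(1,2) assms(7)] by blast
  \<comment> \<open>The constants are chosen in the order of dependence: \<open>\<kappa>\<close> and
    \<open>y\<close> from the angle, \<open>d\<close> from the tolerance, then these, and
    \<open>\<epsilon>\<close> last, small compared with all of them.\<close>
  define S \<alpha> C W \<delta>' where "S = y\<^sup>2 - 3 * \<kappa>" and "\<alpha> = a + \<kappa>" and "C = 2 / (1 - \<alpha>)" and "W = 2 * C + 2"
    and "\<delta>' = min d (\<kappa> / 3)"
  have "1 - \<alpha> > 0" using \<kappa> by (simp add: \<alpha>_def)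
  then have C: "C > 0" "C * (1 - \<alpha>) = 2" by (simp_all add: C_def divide_simps)
  have W: "W > 0" and W': "1 + 2 * C < W" using C by (simp_all add: W_def)
  have \<delta>': "0 < \<delta>'" "\<delta>' \<le> d" "3 * \<delta>' \<le> \<kappa>" using d \<kappa> by (auto simp: \<delta>'_def)
  have "((\<lambda>x. 4 * W\<^sup>2 * x) \<longlongrightarrow> 4 * W\<^sup>2 * 0) (at_right 0)" by (intro tendsto_intros)
  then have ev1: "eventually (\<lambda>x. 4 * W\<^sup>2 * x < \<kappa>) (at_right 0)"
    using \<kappa> by (intro order_tendstoD) auto
  have "((\<lambda>x. S * x / 4 + 2 * (W * x * C)) \<longlongrightarrow> S * 0 / 4 + 2 * (W * 0 * C)) (at_right 0)"
    by (intro tendsto_intros) auto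
  then have ev2: "eventually (\<lambda>x. S * x / 4 + 2 * (W * x * C) < \<delta>') (at_right 0)"
    using \<delta>' by (intro order_tendstoD) auto
  have ev3: "eventually (\<lambda>x::real. x < 1) (at_right 0)"
    by (intro eventually_at_rightI[of 0 1]) auto
  obtain \<epsilon> where eps: "\<epsilon> > 0"
    "4 * W\<^sup>2 * \<epsilon> < \<kappa> \<and> S * \<epsilon> / 4 + 2 * (W * \<epsilon> * C) < \<delta>' \<and> \<epsilon> < 1"
    using eventually_conj[OF ev1 eventually_conj[OF ev2 ev3]] by (rule exists_small_pos)
  \<comment> \<open>The slope gets the margin \<open>y + \<kappa>\<close>, matching
    \<open>S = y^2 - 3 * \<kappa>\<close>. The weight \<open>D = W * \<epsilon> * C\<close> gives
    equality in its condition, as \<open>C * (1 - \<alpha>) = 2\<close>, and vanishes with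
    \<open>\<epsilon>\<close>, as the room needed inside \<open>\<delta>'\<close> requires.\<close>
  interpret collapse_region r S "y + \<kappa>" a \<kappa> \<alpha> C W "W * \<epsilon> * C" \<epsilon> \<delta>'
  proof
    show "0 < S" "S < 1" using \<kappa> a1 by (auto simp: S_def)
    show "y + \<kappa> + 2 * \<kappa> \<le> a - S" using \<kappa> by (simp add: S_def)
    show "r \<le> S * (y + \<kappa>)" using \<kappa> by (simp add: S_def)
    have "y\<^sup>2 \<le> (y + \<kappa>)\<^sup>2" using \<kappa> by (intro power_mono) auto
    then show "S + \<kappa> \<le> (y + \<kappa>)\<^sup>2" using \<kappa> unfolding S_def by linarith
    show "2 * W * \<epsilon> \<le> W * \<epsilon> * C * (1 - \<alpha>)" using C by (simp add: mult.assoc)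
    show "\<kappa> < a" using \<kappa> by linarith
    show "\<delta>' \<le> 1" using \<delta>' \<kappa> \<open>\<kappa> < a\<close> a1 by linarith
  qed (use r \<kappa> C W \<delta>' eps in \<open>auto simp: \<alpha>_def\<close>)
  have "centre e f" unfolding centre_def using ef by (simp add: a_def)
  then obtain ZK :: "'d state set" where ZK: "ZK \<subseteq> phase_space" "top_of_set phase_space interior_of ZK \<noteq> {}"
    and collapse: "\<And>Z0. Z0 \<in> ZK \<Longrightarrow> \<exists>\<tau> Z y1 y2. nearly_linear_collapse r \<tau> Z0 Z \<and>
      ((\<lambda>s. pos (Z s) $ 1 - pos (Z s) $ 0) \<longlongrightarrow> y1) (at_left \<tau>) \<and>
      ((\<lambda>s. pos (Z s) $ 2 - pos (Z s) $ 0) \<longlongrightarrow> y2) (at_left \<tau>) \<and>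
      norm (y1 - e) \<le> \<delta>' \<and> norm (y2 - f) \<le> \<delta>'"
    using collapse_set[of e f] W' eps by (meson less_imp_le)
  show ?thesis
  proof (intro exI[of _ ZK] conjI ballI)
    fix Z0 assume "Z0 \<in> ZK"
    then obtain \<tau> Z y1 y2 where Z: "nearly_linear_collapse r \<tau> Z0 Z"
      "((\<lambda>s. pos (Z s) $ 1 - pos (Z s) $ 0) \<longlongrightarrow> y1) (at_left \<tau>)"
      "((\<lambda>s. pos (Z s) $ 2 - pos (Z s) $ 0) \<longlongrightarrow> y2) (at_left \<tau>)"
      and y: "norm (y1 - e) \<le> \<delta>'" "norm (y2 - f) \<le> \<delta>'"
      using collapse by blast
    have "\<bar>cos (vec_angle y1 y2) - cos \<theta>\<^sub>0\<bar> \<le> \<delta>"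
      using d(2)[of y1 y2] y \<delta>' ef by auto
    then show "\<exists>\<tau> Z \<theta>. nearly_linear_collapse r \<tau> Z0 Z \<and> has_final_angle \<tau> Z \<theta> \<and>
        \<bar>(- cos \<theta>) - (- cos \<theta>\<^sub>0)\<bar> \<le> \<delta>"
      using Z by (intro exI[of _ \<tau>] exI[of _ Z] exI[of _ "vec_angle y1 y2"])
        (auto simp: has_final_angle_def)
  qed (use ZK in auto)
qed

end
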